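(* Let $\Omega\subset\mathbb{R}^2$ be a polygon, $\emptyset\neq\omega\Subset\Omega$ a domain, $(\mathcal{T}^\delta)_{\delta\in I}$ a family of conforming, uniformly shape regular triangulations of $\Omega$, $X^\delta$ the space of piecewise constants w.r.t. $\mathcal{T}^\delta$, $Y^\delta$ the Morley space w.r.t. $\mathcal{T}^\delta$, and let $B^\delta$ and the companion operator $E^\delta\colon Y^\delta\to H^2_0(\Omega)$ be as defined in the context. Let $(\ell,q)\in H^{-2}(\Omega)\times L_2(\omega)$ and define $\ell^\delta\in(Y^\delta)'$ by $$\ell^\delta(v):=\ell(E^\delta v)\qquad(v\in Y^\delta).$$ Then, with a constant $K$ independent of $\delta,\ell,u,z$, for all $\delta\in I$, $u\in L_2(\Omega)$ and $z\in X^\delta$, $$\sup_{0\neq v\in Y^\delta}\frac{|(B^\delta z)(v-E^\delta v)+\ell(E^\delta v)-\ell^\delta(v)|}{\|v\|_{Y^\delta}}\le K\big(\|\ell-Bu\|_{H^{-2}(\Omega)}+\|u-z\|_{L_2(\Omega)}\big)$$ (that is, the data-oscillation condition holds with zero oscillation term).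
   Context: $H^{-2}(\Omega)=(H^2_0(\Omega))'$, and $(Bu)(v):=-\int_\Omega u\,\Delta v\,dx$ for $u\in L_2(\Omega)$, $v\in H^2_0(\Omega)$. Let $\mathcal{N}^\delta$ ($\mathcal{N}^\delta_\circ$) and $\mathcal{E}^\delta$ ($\mathcal{E}^\delta_\circ$) be the sets of (internal) vertices and (internal) edges of $\mathcal{T}^\delta$; $m_e$ is the midpoint of the edge $e$ and $n_e$ a fixed unit normal to $e$. Morley space $Y^\delta$: the piecewise quadratic polynomials w.r.t. $\mathcal{T}^\delta$ that are continuous at $\mathcal{N}^\delta_\circ$ and vanish at $\mathcal{N}^\delta\setminus\mathcal{N}^\delta_\circ$, and whose normal derivatives are continuous at the midpoints of edges in $\mathcal{E}^\delta_\circ$ and vanish at the midpoints of edges in $\mathcal{E}^\delta\setminus\mathcal{E}^\delta_\circ$. It is equipped with the norm $\|v\|_{Y^\delta}:=\big(\sum_{K\in\mathcal{T}^\delta}|v|_{H^2(K)}^2\big)^{1/2}$. $(B^\delta z)(v):=-\sum_{K\in\mathcal{T}^\delta}\int_K z\,\Delta v\,dx$ for $z\in L_2(\Omega)$, $v\in H^2_0(\Omega)+Y^\delta$. HCT space: $\{v\in H^2_0(\Omega)\colon v|_K\in C^1(K),\ v|_{K_i}\in P_3(K_i),\ 1\le i\le3\ (K\in\mathcal{T}^\delta)\}$, where $K_1,K_2,K_3$ is the subdivision of $K$ obtained by connecting its centroid with its vertices. A function in it is determined by its values and gradients at $\nu\in\mathcal{N}^\delta_\circ$ and its normal derivatives at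 $m_e$, $e\in\mathcal{E}^\delta_\circ$ (degrees of freedom on $\partial\Omega$ are zero). For $e\in\mathcal{E}^\delta_\circ$, $b_e$ denotes the HCT nodal basis function with $\partial_{n_e}b_e(m_e)=1$ and all other degrees of freedom zero. $\widetilde E^\delta\colon Y^\delta\to H^2_0(\Omega)$ maps into the HCT space: $(\widetilde E^\delta v)(\nu):=v(\nu)$ and $(\nabla\widetilde E^\delta v)(\nu):=(\nabla v|_{K_\nu})(\nu)$ for $\nu\in\mathcal{N}^\delta_\circ$, where $K_\nu\in\mathcal{T}^\delta$ is some selected triangle containing $\nu$, and $(\partial_{n_e}\widetilde E^\delta v)(m_e):=(\partial_{n_e}v)(m_e)$ for $e\in\mathcal{E}^\delta_\circ$. Finally $$E^\delta v:=\widetilde E^\delta v+\sum_{e\in\mathcal{E}^\delta_\circ}\frac{\int_e\partial_{n_e}(v-\widetilde E^\delta v)\,ds}{\int_e\partial_{n_e}b_e\,ds}\,b_e ,$$ where for $v\in Y^\delta$ the value $\int_e\partial_{n_e}v\,ds=|e|\,(\partial_{n_e}v)(m_e)$ is single-valued. *)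

theory Defs
  imports "HOL-Analysis.Analysis"
begin

section \<open>Derivatives and Sobolev spaces in the plane\<close>

text \<open>
  Elements of \<open>L\<^sub>2\<close> and of Sobolev spaces over an open set \<open>U\<close> are represented by functions on
  the whole plane; only their values almost everywhere on \<open>U\<close> matter.
\<close>

definition pd :: "2 \<Rightarrow> (real^2 \<Rightarrow> real) \<Rightarrow> real^2 \<Rightarrow> real" where
  "pd i f x = frechet_derivative f (at x) (axis i 1)"

definition grad :: "(real^2 \<Rightarrow> real) \<Rightarrow> real^2 \<Rightarrow> real^2" where
  "grad f x = (\<chi> i. pd i f x)"

definition test_functions :: "(real^2) set \<Rightarrow> (real^2 \<Rightarrow> real) set" where
  "test_functions U = {\<phi>. (\<forall>is. foldr pd is \<phi> differentiable_on UNIV) \<and>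
     compact (closure {x. \<phi> x \<noteq> 0}) \<and> closure {x. \<phi> x \<noteq> 0} \<subseteq> U}"

definition L2 :: "(real^2) set \<Rightarrow> (real^2 \<Rightarrow> real) set" where
  "L2 U = {f. f \<in> borel_measurable (lebesgue_on U) \<and> integrable (lebesgue_on U) (\<lambda>x. (f x)\<^sup>2)}"

definition L2_nrm :: "(real^2) set \<Rightarrow> (real^2 \<Rightarrow> real) \<Rightarrow> real" where
  "L2_nrm U f = sqrt (LINT x|lebesgue_on U. (f x)\<^sup>2)"

definition locally_integrable :: "(real^2) set \<Rightarrow> (real^2 \<Rightarrow> real) \<Rightarrow> bool" where
  "locally_integrable U f \<longleftrightarrow> (\<forall>C. compact C \<and> C \<subseteq> U \<longrightarrow> integrable (lebesgue_on C) f)"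

text \<open>A list \<open>is\<close> of coordinate indices stands for the iterated derivative in these directions.\<close>

definition is_weak_deriv ::
  "(real^2) set \<Rightarrow> 2 list \<Rightarrow> (real^2 \<Rightarrow> real) \<Rightarrow> (real^2 \<Rightarrow> real) \<Rightarrow> bool" where
  "is_weak_deriv U is f g \<longleftrightarrow> locally_integrable U f \<and> locally_integrable U g \<and>
     (\<forall>\<phi>\<in>test_functions U.
        (LINT x|lebesgue_on U. f x * foldr pd is \<phi> x) =
        (-1) ^ length is * (LINT x|lebesgue_on U. g x * \<phi> x))"

text \<open>Weak derivatives are unique up to null sets, so the choice does not affect any integral.\<close>

definition wderiv :: "(real^2) set \<Rightarrow> 2 list \<Rightarrow> (real^2 \<Rightarrow> real) \<Rightarrow> real^2 \<Rightarrow> real" where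
  "wderiv U is f = (SOME g. is_weak_deriv U is f g)"

definition wlaplacian :: "(real^2) set \<Rightarrow> (real^2 \<Rightarrow> real) \<Rightarrow> real^2 \<Rightarrow> real" where
  "wlaplacian U f x = (\<Sum>i\<in>UNIV. wderiv U [i, i] f x)"

definition H2 :: "(real^2) set \<Rightarrow> (real^2 \<Rightarrow> real) set" where
  "H2 U = {f \<in> L2 U. \<forall>is. 1 \<le> length is \<and> length is \<le> 2 \<longrightarrow> (\<exists>g\<in>L2 U. is_weak_deriv U is f g)}"

definition H2_seminorm :: "(real^2) set \<Rightarrow> (real^2 \<Rightarrow> real) \<Rightarrow> real" where
  "H2_seminorm U f = sqrt (\<Sum>is | length is = 2. (L2_nrm U (wderiv U is f))\<^sup>2)"

definition H2_norm :: "(real^2) set \<Rightarrow> (real^2 \<Rightarrow> real) \<Rightarrow> real" where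
  "H2_norm U f = sqrt ((L2_nrm U f)\<^sup>2 +
     (\<Sum>is | 1 \<le> length is \<and> length is \<le> 2. (L2_nrm U (wderiv U is f))\<^sup>2))"

definition H20 :: "(real^2) set \<Rightarrow> (real^2 \<Rightarrow> real) set" where
  "H20 U = {f \<in> H2 U. \<exists>\<phi>. (\<forall>n::nat. \<phi> n \<in> test_functions U) \<and>
     (\<lambda>n. H2_norm U (\<lambda>x. f x - \<phi> n x)) \<longlonglongrightarrow> 0}"

text \<open>
  The dual of \<open>H20 U\<close>; boundedness forces a functional to agree on functions that coincide
  almost everywhere on \<open>U\<close>.
\<close>

definition Hm2 :: "(real^2) set \<Rightarrow> ((real^2 \<Rightarrow> real) \<Rightarrow> real) set" where
  "Hm2 U = {l. (\<forall>v\<in>H20 U. \<forall>w\<in>H20 U. \<forall>a b. l (\<lambda>x. a * v x + b * w x) = a * l v + b * l w) \<and>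
     (\<exists>C. \<forall>v\<in>H20 U. \<bar>l v\<bar> \<le> C * H2_norm U v)}"

definition Hm2_norm :: "(real^2) set \<Rightarrow> ((real^2 \<Rightarrow> real) \<Rightarrow> real) \<Rightarrow> ennreal" where
  "Hm2_norm U l = (SUP v\<in>{v \<in> H20 U. H2_norm U v \<noteq> 0}. ennreal (\<bar>l v\<bar> / H2_norm U v))"

definition B_op :: "(real^2) set \<Rightarrow> (real^2 \<Rightarrow> real) \<Rightarrow> (real^2 \<Rightarrow> real) \<Rightarrow> real" where
  "B_op \<Omega> u v = - (LINT x|lebesgue_on \<Omega>. u x * wlaplacian \<Omega> v x)"

section \<open>Polygons and triangulations\<close>

text \<open>
  A polygon may have holes; regular openness (\<open>interior (closure \<Omega>) = \<Omega>\<close>) excludes slits.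
\<close>

definition polygon :: "(real^2) set \<Rightarrow> bool" where
  "polygon \<Omega> \<longleftrightarrow> \<Omega> \<noteq> {} \<and> open \<Omega> \<and> connected \<Omega> \<and> bounded \<Omega> \<and> interior (closure \<Omega>) = \<Omega> \<and>
     (\<exists>S. finite S \<and> (\<forall>s\<in>S. \<exists>a b. s = closed_segment a b) \<and> frontier \<Omega> = \<Union>S)"

text \<open>The library notion \<open>triangulation\<close> already requires intersections to be common faces.\<close>

definition conforming_triangulation :: "(real^2) set \<Rightarrow> (real^2) set set \<Rightarrow> bool" where
  "conforming_triangulation \<Omega> T \<longleftrightarrow>
     triangulation T \<and> (\<forall>K\<in>T. (2 simplex K)) \<and> \<Union>T = closure \<Omega>"

definition uniformly_shape_regular :: "'i set \<Rightarrow> ('i \<Rightarrow> (real^2) set set) \<Rightarrow> bool" where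
  "uniformly_shape_regular I T \<longleftrightarrow>
     (\<exists>\<sigma>. \<forall>\<delta>\<in>I. \<forall>K\<in>T \<delta>. \<exists>x r. r > 0 \<and> cball x r \<subseteq> K \<and> diameter K \<le> \<sigma> * r)"

definition vertices :: "(real^2) set set \<Rightarrow> (real^2) set" where
  "vertices T = {\<nu>. \<exists>K\<in>T. (\<nu> extreme_point_of K)}"

definition int_vertices :: "(real^2) set \<Rightarrow> (real^2) set set \<Rightarrow> (real^2) set" where
  "int_vertices \<Omega> T = vertices T \<inter> \<Omega>"

definition edges :: "(real^2) set set \<Rightarrow> (real^2) set set" where
  "edges T = {e. \<exists>K\<in>T. (e edge_of K)}"

definition int_edges :: "(real^2) set \<Rightarrow> (real^2) set set \<Rightarrow> (real^2) set set" where
  "int_edges \<Omega> T = {e \<in> edges T. \<not> e \<subseteq> frontier \<Omega>}"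

definition ends :: "(real^2) set \<Rightarrow> (real^2) \<times> (real^2)" where
  "ends e = (SOME p. e = closed_segment (fst p) (snd p))"

definition edge_midpoint :: "(real^2) set \<Rightarrow> real^2" where
  "edge_midpoint e = midpoint (fst (ends e)) (snd (ends e))"

definition edge_integral :: "(real^2) set \<Rightarrow> (real^2 \<Rightarrow> real) \<Rightarrow> real" where
  "edge_integral e f = (case ends e of (a, b) \<Rightarrow>
     dist a b * integral {0..1} (\<lambda>t. f ((1 - t) *\<^sub>R a + t *\<^sub>R b)))"

definition unit_normals :: "(real^2) set set \<Rightarrow> ((real^2) set \<Rightarrow> real^2) \<Rightarrow> bool" where
  "unit_normals T n \<longleftrightarrow>
     (\<forall>e\<in>edges T. norm (n e) = 1 \<and> (\<forall>x\<in>e. \<forall>y\<in>e. n e \<bullet> (x - y) = 0))"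

section \<open>Finite element spaces\<close>

text \<open>\<open>tr K f x\<close> is the value at \<open>x \<in> K\<close> of the restriction of \<open>f\<close> to the triangle \<open>K\<close>.\<close>

definition tr :: "(real^2) set \<Rightarrow> (real^2 \<Rightarrow> 'a::t2_space) \<Rightarrow> real^2 \<Rightarrow> 'a" where
  "tr K f x = Lim (at x within interior K) f"

definition ndtr :: "(real^2) set \<Rightarrow> real^2 \<Rightarrow> (real^2 \<Rightarrow> real) \<Rightarrow> real^2 \<Rightarrow> real" where
  "ndtr K n f x = n \<bullet> tr K (grad f) x"

definition poly2 :: "nat \<Rightarrow> (real^2 \<Rightarrow> real) set" where
  "poly2 k = {p. \<exists>c. \<forall>x. p x = (\<Sum>i\<le>k. \<Sum>j\<le>k - i. c i j * (x $ 1) ^ i * (x $ 2) ^ j)}"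

definition pw_const :: "(real^2) set set \<Rightarrow> (real^2 \<Rightarrow> real) set" where
  "pw_const T = {z. \<forall>K\<in>T. \<exists>c. \<forall>x\<in>interior K. z x = c}"

definition morley ::
  "(real^2) set \<Rightarrow> (real^2) set set \<Rightarrow> ((real^2) set \<Rightarrow> real^2) \<Rightarrow> (real^2 \<Rightarrow> real) set" where
  "morley \<Omega> T n = {v.
     (\<forall>K\<in>T. \<exists>p\<in>poly2 2. \<forall>x\<in>interior K. v x = p x) \<and>
     (\<forall>\<nu>\<in>int_vertices \<Omega> T. \<forall>K\<in>T. \<forall>K'\<in>T. \<nu> \<in> K \<and> \<nu> \<in> K' \<longrightarrow> tr K v \<nu> = tr K' v \<nu>) \<and>
     (\<forall>\<nu>\<in>vertices T - int_vertices \<Omega> T. \<forall>K\<in>T. \<nu> \<in> K \<longrightarrow> tr K v \<nu> = 0) \<and>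
     (\<forall>e\<in>int_edges \<Omega> T. \<forall>K\<in>T. \<forall>K'\<in>T. (e edge_of K) \<and> (e edge_of K') \<longrightarrow>
        ndtr K (n e) v (edge_midpoint e) = ndtr K' (n e) v (edge_midpoint e)) \<and>
     (\<forall>e\<in>edges T - int_edges \<Omega> T. \<forall>K\<in>T. (e edge_of K) \<longrightarrow>
        ndtr K (n e) v (edge_midpoint e) = 0)}"

text \<open>Values on the skeleton of the triangulation, a null set, are irrelevant.\<close>

definition pw_nonzero :: "(real^2) set set \<Rightarrow> (real^2 \<Rightarrow> real) \<Rightarrow> bool" where
  "pw_nonzero T v \<longleftrightarrow> (\<exists>K\<in>T. \<exists>x\<in>interior K. v x \<noteq> 0)"

definition morley_norm :: "(real^2) set set \<Rightarrow> (real^2 \<Rightarrow> real) \<Rightarrow> real" where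
  "morley_norm T v = sqrt (\<Sum>K\<in>T. (H2_seminorm (interior K) v)\<^sup>2)"

definition B_disc :: "(real^2) set set \<Rightarrow> (real^2 \<Rightarrow> real) \<Rightarrow> (real^2 \<Rightarrow> real) \<Rightarrow> real" where
  "B_disc T z v = - (\<Sum>K\<in>T. LINT x|lebesgue_on (interior K). z x * wlaplacian (interior K) v x)"

definition centroid :: "(real^2) set \<Rightarrow> real^2" where
  "centroid K = (1 / 3) *\<^sub>R (\<Sum>\<nu> | \<nu> extreme_point_of K. \<nu>)"

definition C1_on_triangle :: "(real^2) set \<Rightarrow> (real^2 \<Rightarrow> real) \<Rightarrow> bool" where
  "C1_on_triangle K v \<longleftrightarrow> (\<forall>x\<in>interior K. v differentiable (at x)) \<and>
     (\<exists>f. continuous_on K f \<and> (\<forall>x\<in>interior K. f x = v x)) \<and>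
     (\<exists>g. continuous_on K g \<and> (\<forall>x\<in>interior K. g x = grad v x))"

text \<open>Each of the three subtriangles is spanned by an edge of \<open>K\<close> and the centroid.\<close>

definition HCT :: "(real^2) set \<Rightarrow> (real^2) set set \<Rightarrow> (real^2 \<Rightarrow> real) set" where
  "HCT \<Omega> T = {v \<in> H20 \<Omega>. \<forall>K\<in>T. C1_on_triangle K v \<and>
     (\<forall>e. (e edge_of K) \<longrightarrow>
       (\<exists>p\<in>poly2 3. \<forall>x\<in>interior (convex hull (insert (centroid K) e)). v x = p x))}"

text \<open>
  \<open>has_HCT_dofs \<Omega> T n w a g d\<close>: the function \<open>w\<close> has nodal values \<open>a\<close>, nodal gradients \<open>g\<close> and
  normal derivatives \<open>d\<close> at midpoints, with zero degrees of freedom on the boundary.  As an element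
  of \<open>HCT\<close> is \<open>C\<^sup>1\<close>, these values are the same seen from every adjacent triangle.
\<close>

definition has_HCT_dofs ::
  "(real^2) set \<Rightarrow> (real^2) set set \<Rightarrow> ((real^2) set \<Rightarrow> real^2) \<Rightarrow> (real^2 \<Rightarrow> real) \<Rightarrow>
   (real^2 \<Rightarrow> real) \<Rightarrow> (real^2 \<Rightarrow> real^2) \<Rightarrow> ((real^2) set \<Rightarrow> real) \<Rightarrow> bool" where
  "has_HCT_dofs \<Omega> T n w a g d \<longleftrightarrow>
     (\<forall>K\<in>T. \<forall>\<nu>\<in>vertices T. \<nu> \<in> K \<longrightarrow>
        tr K w \<nu> = (if \<nu> \<in> int_vertices \<Omega> T then a \<nu> else 0) \<and>
        tr K (grad w) \<nu> = (if \<nu> \<in> int_vertices \<Omega> T then g \<nu> else 0)) \<and>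
     (\<forall>K\<in>T. \<forall>e. (e edge_of K) \<longrightarrow>
        ndtr K (n e) w (edge_midpoint e) = (if e \<in> int_edges \<Omega> T then d e else 0))"

definition HCT_edge_basis ::
  "(real^2) set \<Rightarrow> (real^2) set set \<Rightarrow> ((real^2) set \<Rightarrow> real^2) \<Rightarrow>
   ((real^2) set \<Rightarrow> real^2 \<Rightarrow> real) \<Rightarrow> bool" where
  "HCT_edge_basis \<Omega> T n b \<longleftrightarrow> (\<forall>e\<in>int_edges \<Omega> T. b e \<in> HCT \<Omega> T \<and>
     has_HCT_dofs \<Omega> T n (b e) (\<lambda>_. 0) (\<lambda>_. 0) (\<lambda>e'. if e' = e then 1 else 0))"

text \<open>
  Quantities of a Morley function that are single-valued, namely its values at vertices and its
  normal derivatives at (equivalently, their mean over) edges, are read off from an arbitrary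
  adjacent triangle.
\<close>

definition elt_at_vertex :: "(real^2) set set \<Rightarrow> real^2 \<Rightarrow> (real^2) set" where
  "elt_at_vertex T \<nu> = (SOME K. K \<in> T \<and> \<nu> \<in> K)"

definition elt_at_edge :: "(real^2) set set \<Rightarrow> (real^2) set \<Rightarrow> (real^2) set" where
  "elt_at_edge T e = (SOME K. K \<in> T \<and> (e edge_of K))"

definition ndtr_edge ::
  "(real^2) set set \<Rightarrow> ((real^2) set \<Rightarrow> real^2) \<Rightarrow> (real^2) set \<Rightarrow> (real^2 \<Rightarrow> real) \<Rightarrow> real^2 \<Rightarrow> real"
  where "ndtr_edge T n e v = ndtr (elt_at_edge T e) (n e) v"

definition vertex_selection ::
  "(real^2) set \<Rightarrow> (real^2) set set \<Rightarrow> (real^2 \<Rightarrow> (real^2) set) \<Rightarrow> bool" where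
  "vertex_selection \<Omega> T sel \<longleftrightarrow> (\<forall>\<nu>\<in>int_vertices \<Omega> T. sel \<nu> \<in> T \<and> \<nu> \<in> sel \<nu>)"

definition HCT_interpolator ::
  "(real^2) set \<Rightarrow> (real^2) set set \<Rightarrow> ((real^2) set \<Rightarrow> real^2) \<Rightarrow> (real^2 \<Rightarrow> (real^2) set) \<Rightarrow>
   ((real^2 \<Rightarrow> real) \<Rightarrow> real^2 \<Rightarrow> real) \<Rightarrow> bool" where
  "HCT_interpolator \<Omega> T n sel Et \<longleftrightarrow> (\<forall>v\<in>morley \<Omega> T n. Et v \<in> HCT \<Omega> T \<and>
     has_HCT_dofs \<Omega> T n (Et v)
       (\<lambda>\<nu>. tr (elt_at_vertex T \<nu>) v \<nu>)
       (\<lambda>\<nu>. tr (sel \<nu>) (grad v) \<nu>)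
       (\<lambda>e. ndtr_edge T n e v (edge_midpoint e)))"

definition companion ::
  "(real^2) set \<Rightarrow> (real^2) set set \<Rightarrow> ((real^2) set \<Rightarrow> real^2) \<Rightarrow>
   ((real^2 \<Rightarrow> real) \<Rightarrow> real^2 \<Rightarrow> real) \<Rightarrow> ((real^2) set \<Rightarrow> real^2 \<Rightarrow> real) \<Rightarrow>
   (real^2 \<Rightarrow> real) \<Rightarrow> real^2 \<Rightarrow> real" where
  "companion \<Omega> T n Et b v x = Et v x +
     (\<Sum>e\<in>int_edges \<Omega> T.
        edge_integral e (ndtr_edge T n e (\<lambda>y. v y - Et v y)) /
        edge_integral e (ndtr_edge T n e (b e)) * b e x)"

end

theory Submission
  imports Defs "HOL-Computational_Algebra.Polynomial"
begin

text \<open>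
  The numerator vanishes identically. Since \<open>z\<close> is constant on each triangle \<open>K\<close>, it suffices that
  \<open>\<Delta> (v - E v)\<close> has mean zero on \<open>K\<close>, and by Gauss' theorem this is the sum of the fluxes of
  \<open>grad (v - E v)\<close> through the edges of \<open>K\<close>. The correction by the functions \<open>b\<^sub>e\<close> makes the flux
  through an interior edge vanish from one side; the midpoint rule (on \<open>v\<close>) and Simpson's rule (on
  HCT functions, whose normal derivatives are quadratic along an edge) express fluxes through the
  degrees of freedom, so that it vanishes from the other side as well.

  The Laplacian on \<open>K\<close> is a weak one, so Gauss' theorem is obtained by testing with smooth cut-offs
  \<open>\<phi>\<^sub>n\<close>, products of functions of the barycentric coordinates, that increase to \<open>1\<close> on \<open>K\<close>: the
  gradients of \<open>\<phi>\<^sub>n\<close> concentrate on the edges, and \<open>- \<integral> grad w \<bullet> grad \<phi>\<^sub>n\<close> tends to the sum of fluxes.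
  This needs no uniqueness of weak derivatives.
\<close>

section \<open>Affine coordinates in the plane\<close>

text \<open>\<open>wderiv\<close> selects one weak derivative per function by choice, so the
  Laplacian of \<open>v - E v\<close> cannot be split into those of \<open>v\<close> and
  \<open>E v\<close> before uniqueness is known. The defect is therefore kept as one function, of
  which two facts enter: second weak derivatives exist on each open triangle, and the classical
  gradient extends continuously to the closed triangle. This suits HCT functions, whose second
  derivatives may jump across the inner edges of a macro triangle. As all fluxes are to vanish, the
  layers along the edges need no normalisation. Simpson's rule involves only the gradients at the
  end points and the normal derivative at the midpoint, which are degrees of freedom shared by both
  sides. It gives \<open>b e\<close> the mean flux 4/6 = 2/3 through \<open>e\<close> and 0 through
  every other edge, so the corrections do not interact and their denominators are nonzero. Along a
  boundary edge all these degrees of freedom are zero.\<close>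

definition cross2 :: "real^2 \<Rightarrow> real^2 \<Rightarrow> real" where
  "cross2 u v = u $ 1 * v $ 2 - u $ 2 * v $ 1"

lemma linear_cross2_right: "linear (cross2 u)"
  by (rule linearI) (auto simp: cross2_def algebra_simps)

lemma cross2_div_cont:
  assumes "d \<noteq> 0"
  shows "continuous_on UNIV (\<lambda>x. cross2 (x - a) q / d)" "continuous_on UNIV (\<lambda>x. cross2 p (x - a) / d)"
proof -
  have "continuous_on UNIV (\<lambda>x. cross2 (x - a) q)" "continuous_on UNIV (\<lambda>x. cross2 p (x - a))"
    unfolding cross2_def by (intro continuous_intros)+
  then show "continuous_on UNIV (\<lambda>x. cross2 (x - a) q / d)" "continuous_on UNIV (\<lambda>x. cross2 p (x - a) / d)"
    using assms by (auto intro: continuous_on_divide)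
qed

lemma cramer2:
  assumes "cross2 p q \<noteq> 0"
  shows "(cross2 x q / cross2 p q) *\<^sub>R p + (cross2 p x / cross2 p q) *\<^sub>R q = x"
proof -
  have "(cross2 x q / cross2 p q) * p $ i + (cross2 p x / cross2 p q) * q $ i = x $ i" for i
  proof -
    have "cross2 x q * p $ i + cross2 p x * q $ i = x $ i * cross2 p q"
      using exhaust_2[of i] by (auto simp: cross2_def algebra_simps)
    then show ?thesis using assms by (simp add: field_simps)
  qed
  then show ?thesis by (simp add: vec_eq_iff)
qed

text \<open>A linear image scales Lebesgue measure by the absolute determinant, here
  \<open>cross2 p q\<close>, and translation preserves it. Cramer's rule then describes the same set
  by its coordinates and shows that it is open; being Borel, it has the same measure under
  \<open>lborel\<close> as under the completion.\<close>

lemma emeasure_parallelogram: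
  fixes p q a :: "real^2"
  assumes "l1 \<le> u1" "l2 \<le> u2" and D: "cross2 p q \<noteq> 0"
  shows "emeasure lborel ((\<lambda>y::real^2. a + (y$1) *\<^sub>R p + (y$2) *\<^sub>R q) ` box (vector [l1,l2]) (vector [u1,u2]))
    = ennreal (\<bar>cross2 p q\<bar> * ((u1 - l1) * (u2 - l2)))" (is "emeasure lborel (?g ` ?B) = _")
proof -
  define A where "A y = (y$1) *\<^sub>R p + (y$2) *\<^sub>R q" for y :: "real^2"
  have lin: "linear A"
    by (rule linearI) (auto simp: A_def algebra_simps)
  have m: "det (matrix A) = cross2 p q"
    by (simp add: det_2 matrix_def A_def cross2_def axis_def)
  have Bm: "?B \<in> lmeasurable" by simp
  have le: "\<And>b. b \<in> Basis \<Longrightarrow> vector [l1,l2] \<bullet> b \<le> (vector [u1,u2] :: real^2) \<bullet> b"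
  proof -
    fix b :: "real^2" assume "b \<in> Basis"
    then obtain i where "b = axis i 1" by (auto simp: Basis_vec_def)
    then show "vector [l1,l2] \<bullet> b \<le> (vector [u1,u2] :: real^2) \<bullet> b"
      using assms exhaust_2[of i] by (auto simp: inner_axis)
  qed
  have prodB: "(\<Prod>b\<in>Basis. (vector [u1,u2] - vector [l1,l2] :: real^2) \<bullet> b) = (u1 - l1) * (u2 - l2)"
  proof -
    have B: "(Basis :: (real^2) set) = (\<lambda>i. axis i 1) ` UNIV" by (auto simp: Basis_vec_def)
    have "(\<Prod>b\<in>Basis. (vector [u1,u2] - vector [l1,l2] :: real^2) \<bullet> b)
      = (\<Prod>i\<in>UNIV. (vector [u1,u2] - vector [l1,l2] :: real^2) \<bullet> axis i 1)"
      unfolding B by (subst prod.reindex) (auto simp: inj_on_def axis_eq_axis)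
    then show ?thesis by (simp add: UNIV_2 inner_axis)
  qed
  have mB: "measure lebesgue ?B = (u1 - l1) * (u2 - l2)"
  proof -
    have "measure lebesgue ?B = enn2real (emeasure lborel ?B)" by (simp add: measure_def)
    also have "\<dots> = enn2real (ennreal ((u1 - l1) * (u2 - l2)))"
      by (rule arg_cong[where f=enn2real]) (use emeasure_lborel_box[OF le] prodB in simp)
    also have "\<dots> = (u1 - l1) * (u2 - l2)" using assms by (intro enn2real_ennreal) simp
    finally show ?thesis .
  qed
  have img: "?g ` ?B = (+) a ` (A ` ?B)"
    by (auto simp: A_def image_image add.assoc)
  have meas: "?g ` ?B \<in> lmeasurable"
    unfolding img by (intro measurable_translation measurable_linear_image lin Bm)
  have "measure lebesgue (?g ` ?B) = \<bar>cross2 p q\<bar> * ((u1 - l1) * (u2 - l2))"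
    unfolding img measure_translation using measure_linear_image[OF lin Bm] by (simp add: m mB)
  then have e: "emeasure lebesgue (?g ` ?B) = ennreal (\<bar>cross2 p q\<bar> * ((u1 - l1) * (u2 - l2)))"
    using emeasure_eq_measure2[OF meas] by simp
  have "?g ` ?B = {x. cross2 (x - a) q / cross2 p q \<in> {l1<..<u1} \<and>
                      cross2 p (x - a) / cross2 p q \<in> {l2<..<u2}}" (is "_ = ?S")
  proof (intro subset_antisym subsetI)
    fix x assume "x \<in> ?g ` ?B"
    then obtain y where "y \<in> ?B" and x: "x = ?g y" by auto
    moreover have "cross2 (x - a) q = y$1 * cross2 p q" "cross2 p (x - a) = y$2 * cross2 p q"
      unfolding x cross2_def by (auto simp: algebra_simps)
    ultimately show "x \<in> ?S" using D by (auto simp: mem_box_cart forall_2)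
  next
    fix x assume x: "x \<in> ?S"
    let ?y = "vector [cross2 (x - a) q / cross2 p q, cross2 p (x - a) / cross2 p q] :: real^2"
    have "?y \<in> ?B" using x by (auto simp: mem_box_cart forall_2)
    moreover have "?g ?y = x" unfolding vector_2 add.assoc cramer2[OF D] by simp
    ultimately show "x \<in> ?g ` ?B" by (intro image_eqI[where x="?y"]) (simp_all only:)
  qed
  moreover have "?S \<in> sets borel"
  proof -
    have 1: "continuous_on UNIV (\<lambda>x. cross2 (x - a) q / cross2 p q)"
      "continuous_on UNIV (\<lambda>x. cross2 p (x - a) / cross2 p q)"
      by (intro cross2_div_cont D)+
    have S: "?S = (\<lambda>x. cross2 (x - a) q / cross2 p q) -` {l1<..<u1} \<inter>
               (\<lambda>x. cross2 p (x - a) / cross2 p q) -` {l2<..<u2}" by auto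
    have "open ?S" unfolding S by (intro open_Int open_vimage 1 open_greaterThanLessThan)
    then show ?thesis by simp
  qed
  ultimately have "?g ` ?B \<in> sets lborel" by simp
  then show ?thesis using e by simp
qed

context
  fixes a p q :: "real^2"
  assumes D: "cross2 p q \<noteq> 0"
begin

definition "coords x = (cross2 (x - a) q / cross2 p q, cross2 p (x - a) / cross2 p q)"

text \<open>\<open>lborel\<close> is determined by its values on boxes. The preimage of a box under
  \<open>coords\<close> is a parallelogram, and its area carries the factor
  \<open>\<bar>cross2 p q\<bar>\<close> that the density removes.\<close>

lemma lborel_coords:
  "(lborel :: (real \<times> real) measure) =
     density (distr lborel borel coords) (\<lambda>_. ennreal (1 / \<bar>cross2 p q\<bar>))" (is "_ = ?M")
proof (rule lborel_eqI)
  have cont: "continuous_on UNIV coords"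
    unfolding coords_def by (intro continuous_on_Pair cross2_div_cont D)
  then have [measurable]: "coords \<in> borel_measurable borel"
    by (rule borel_measurable_continuous_onI)
  show "sets ?M = sets borel" by simp
  fix l u :: "real \<times> real"
  assume le: "\<And>b. b \<in> Basis \<Longrightarrow> l \<bullet> b \<le> u \<bullet> b"
  have le1: "fst l \<le> fst u" "snd l \<le> snd u"
    using le[of "(1,0)"] le[of "(0,1)"] by (auto simp: Basis_prod_def inner_prod_def)
  have B: "box l u = {fst l<..<fst u} \<times> {snd l<..<snd u}"
    by (auto simp: mem_box Basis_prod_def inner_prod_def)
  have pr: "(\<Prod>b\<in>Basis. (u - l) \<bullet> b) = (fst u - fst l) * (snd u - snd l)"
    by (simp add: Basis_prod_def inner_prod_def inner_diff_left)
  let ?g = "\<lambda>y::real^2. a + (y$1) *\<^sub>R p + (y$2) *\<^sub>R q"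
  let ?B = "box (vector [fst l, snd l]) (vector [fst u, snd u]) :: (real^2) set"
  have v: "coords -` box l u = ?g ` ?B"
  proof (intro subset_antisym subsetI)
    fix x assume x: "x \<in> coords -` box l u"
    let ?y = "vector [fst (coords x), snd (coords x)] :: real^2"
    have "?y \<in> ?B" using x by (auto simp: mem_box_cart forall_2 B)
    moreover have "?g ?y = x" unfolding vector_2 coords_def fst_conv snd_conv add.assoc cramer2[OF D] by simp
    ultimately show "x \<in> ?g ` ?B" by (intro image_eqI[where x="?y"]) (simp_all only:)
  next
    fix x assume "x \<in> ?g ` ?B"
    then obtain y where "y \<in> ?B" and x: "x = ?g y" by auto
    moreover have "cross2 (x - a) q = y$1 * cross2 p q" "cross2 p (x - a) = y$2 * cross2 p q"
      unfolding x cross2_def by (auto simp: algebra_simps)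
    ultimately show "x \<in> coords -` box l u"
      using D by (auto simp: mem_box_cart forall_2 coords_def B)
  qed
  have "emeasure ?M (box l u) = ennreal (1 / \<bar>cross2 p q\<bar>) * emeasure lborel (coords -` box l u)"
    by (subst emeasure_density_const) (auto simp: emeasure_distr)
  also have "\<dots> = ennreal ((fst u - fst l) * (snd u - snd l))"
    unfolding v using le1 D by (simp add: emeasure_parallelogram flip: ennreal_mult)
  finally show "emeasure ?M (box l u) = (\<Prod>b\<in>Basis. (u - l) \<bullet> b)" by (simp add: pr)
qed

lemma coords_inverse: "a + fst (coords x) *\<^sub>R p + snd (coords x) *\<^sub>R q = x"
  unfolding coords_def fst_conv snd_conv add.assoc cramer2[OF D] by simp

lemma coords_borel: "coords \<in> borel_measurable borel"
  unfolding coords_def by (intro borel_measurable_continuous_onI continuous_on_Pair cross2_div_cont D)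

end

context
  fixes a p q :: "real^2" and f :: "real^2 \<Rightarrow> real"
  assumes D: "cross2 p q \<noteq> 0" and f [measurable]: "f \<in> borel_measurable borel"
begin

lemma affine_param_borel:
  "(\<lambda>y::real\<times>real. f (a + fst y *\<^sub>R p + snd y *\<^sub>R q)) \<in> borel_measurable borel"
proof -
  have "(\<lambda>y::real\<times>real. a + fst y *\<^sub>R p + snd y *\<^sub>R q) \<in> borel_measurable borel"
    by (intro borel_measurable_continuous_onI continuous_intros)
  then show ?thesis by measurable
qed

text \<open>The passage from \<open>real^2\<close> to the product type is what makes Fubini
  available. Borel measurability suffices, because a nonintegrable \<open>f\<close> gives 0 on both
  sides.\<close>

lemma integral_affine_param:
  "(\<integral>x. f x \<partial>lborel) = \<bar>cross2 p q\<bar> * (\<integral>y. f (a + fst y *\<^sub>R p + snd y *\<^sub>R q) \<partial>(lborel :: (real \<times> real) measure))"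
proof -
  note [measurable] = coords_borel[OF D, of a] affine_param_borel
  have "(\<integral>y. f (a + fst y *\<^sub>R p + snd y *\<^sub>R q) \<partial>(lborel :: (real \<times> real) measure))
    = (1 / \<bar>cross2 p q\<bar>) * (\<integral>x. f x \<partial>lborel)"
    by (subst lborel_coords[OF D, of a])
       (simp add: integral_density integral_distr coords_inverse[OF D])
  then show ?thesis using D by simp
qed

lemma integrable_affine_param:
  "integrable (lborel :: (real \<times> real) measure) (\<lambda>y. f (a + fst y *\<^sub>R p + snd y *\<^sub>R q))
    \<longleftrightarrow> integrable lborel f"
proof -
  note [measurable] = coords_borel[OF D, of a] affine_param_borel
  show ?thesis
    using D integrable_mult_left_iff[of lborel "1 / \<bar>cross2 p q\<bar>" f]
    by (subst lborel_coords[OF D, of a])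
       (simp add: integrable_density integrable_distr_eq coords_inverse[OF D])
qed

end

section \<open>Smooth cut-off functions\<close>

lemma pd_eqI: "(f has_derivative f') (at x) \<Longrightarrow> pd i f x = f' (axis i 1)"
  unfolding pd_def by (simp add: frechet_derivative_at[symmetric])

text \<open>Differentiability is not assumed: \<open>f\<close> and \<open>g\<close> have the same
  derivatives at \<open>x\<close>, so the choice inside \<open>frechet_derivative\<close> returns
  the same one.\<close>

lemma pd_cong_open:
  assumes "open U" "x \<in> U" "\<And>y. y \<in> U \<Longrightarrow> f y = g y"
  shows "pd i f x = pd i g x"
proof -
  have "(f has_derivative D) (at x) = (g has_derivative D) (at x)" for D
    using has_derivative_transform_within_open[OF _ assms(1,2)] assms(3) by metis
  then show ?thesis unfolding pd_def frechet_derivative_def by simp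
qed

lemma has_derivative_pd:
  assumes "f differentiable (at x)"
  shows "(f has_derivative (\<lambda>h. \<Sum>i\<in>UNIV. pd i f x * h $ i)) (at x)"
proof -
  obtain D where D: "(f has_derivative D) (at x)" using assms by (auto simp: differentiable_def)
  interpret bounded_linear D using D by (rule has_derivative_bounded_linear)
  have "D h = (\<Sum>i\<in>UNIV. pd i f x * h $ i)" for h :: "real^2"
  proof -
    have "D h = D (\<Sum>i\<in>UNIV. h $ i *\<^sub>R axis i 1)"
      by (rule arg_cong[where f=D]) (simp add: vec_eq_iff sum_2 axis_def forall_2)
    also have "\<dots> = (\<Sum>i\<in>UNIV. pd i f x * h $ i)"
      by (simp add: sum scaleR pd_eqI[OF D] mult.commute)
    finally show ?thesis .
  qed
  then show ?thesis using D by presburger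
qed

lemma has_derivative_grad: "f differentiable (at x) \<Longrightarrow> (f has_derivative (\<lambda>h. grad f x \<bullet> h)) (at x)"
  using has_derivative_pd[of f x] by (simp add: grad_def inner_vec_def)

lemma pd_0_outside:
  assumes "closed C" "\<And>y. y \<notin> C \<Longrightarrow> f y = 0" "x \<notin> C"
  shows "pd i f x = 0"
proof -
  have "pd i f x = pd i (\<lambda>_. 0) x"
    by (rule pd_cong_open[of "- C"]) (use assms in auto)
  also have "\<dots> = 0" using pd_eqI[OF has_derivative_const] .
  finally show ?thesis .
qed

text \<open>The classical function that is flat at 0, with a polynomial factor as a parameter: this
  makes the family closed under differentiation, so smoothness of all orders follows from one
  derivative formula.\<close>

definition bump :: "real poly \<Rightarrow> real \<Rightarrow> real" where
  "bump p t = (if t > 0 then poly p (1 / t) * exp (- (1 / t)) else 0)"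

lemma poly_times_exp_minus_tendsto_0: "((\<lambda>x::real. poly p x * exp (- x)) \<longlongrightarrow> 0) at_top"
proof -
  have "((\<lambda>x. \<Sum>i\<le>degree p. coeff p i * (x ^ i / exp x)) \<longlongrightarrow> (\<Sum>i\<le>degree p. coeff p i * 0)) at_top"
    by (intro tendsto_sum tendsto_mult tendsto_const tendsto_power_div_exp_0)
  then show ?thesis
    by (simp add: poly_altdef sum_distrib_right exp_minus field_simps sum_divide_distrib)
qed

text \<open>With s = 1/t one has d/dt = - s^2 d/ds, and d/ds maps p(s) exp(-s) to (p'(s) - p(s))
  exp(-s); hence the new polynomial s^2 (p - p').\<close>

lemma bump_has_derivative:
  "(bump p has_real_derivative bump (monom 1 2 * (p - pderiv p)) t) (at t)"
proof (rule linorder_cases[of t 0])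
  assume t: "t < 0"
  have "((\<lambda>_. 0) has_real_derivative 0) (at t)" by simp
  then have "(bump p has_real_derivative 0) (at t)"
    by (rule has_field_derivative_transform_within_open[where S="{..<0}"]) (use t in \<open>auto simp: bump_def\<close>)
  then show ?thesis using t by (simp add: bump_def)
next
  assume t: "t > 0"
  have inv: "((\<lambda>t. 1 / t) has_real_derivative - (1 / t^2)) (at t)"
    using t by (auto intro!: derivative_eq_intros simp: power2_eq_square)
  note DERIV_mult[OF DERIV_chain2[OF poly_DERIV[of p] inv] DERIV_chain2[OF DERIV_exp DERIV_minus[OF inv]]]
  then have "(bump p has_real_derivative
     poly (pderiv p) (1 / t) * - (1 / t^2) * exp (- (1 / t)) +
     exp (- (1 / t)) * (- (- (1 / t^2))) * poly p (1 / t)) (at t)"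
    by (rule has_field_derivative_transform_within_open[where S="{0<..}"]) (use t in \<open>auto simp: bump_def\<close>)
  then show ?thesis
    using t by (simp add: bump_def poly_monom field_simps power2_eq_square)
next
  assume t: "t = 0"
  have "((\<lambda>h. bump p h / h) \<longlongrightarrow> 0) (at_right 0)"
  proof -
    \<comment> \<open>\<open>pCons 0 p\<close> is X times \<open>p\<close>; the extra factor 1/h is
      the division in the difference quotient.\<close>
    have "((\<lambda>h. poly (pCons 0 p) (inverse h) * exp (- inverse h)) \<longlongrightarrow> 0) (at_right (0::real))"
      using filterlim_compose[OF poly_times_exp_minus_tendsto_0 filterlim_inverse_at_top_right] .
    then show ?thesis
      by (rule Lim_transform_eventually)
         (auto simp: eventually_at_filter bump_def field_simps intro!: always_eventually)
  qed
  moreover have "((\<lambda>h. bump p h / h) \<longlongrightarrow> 0) (at_left 0)"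
    by (rule Lim_transform_eventually[OF tendsto_const])
       (auto simp: eventually_at_filter bump_def)
  ultimately have "((\<lambda>h. bump p h / h) \<longlongrightarrow> 0) (at 0)"
    by (simp add: filterlim_split_at)
  then show ?thesis using t by (simp add: DERIV_def bump_def)
qed

lemma bump_continuous: "continuous_on S (bump p)"
  using DERIV_isCont[OF bump_has_derivative] by (blast intro: continuous_at_imp_continuous_on)

text \<open>An algebra of smooth functions, closed under partial derivatives, that contains the cut-offs
  of a triangle.\<close>

inductive_set bump_algebra :: "(real^2 \<Rightarrow> real) set" where
  bump: "(\<lambda>x. bump p (\<alpha> \<bullet> x + \<beta>)) \<in> bump_algebra"
| scale: "f \<in> bump_algebra \<Longrightarrow> (\<lambda>x. c * f x) \<in> bump_algebra"
| add: "f \<in> bump_algebra \<Longrightarrow> g \<in> bump_algebra \<Longrightarrow> (\<lambda>x. f x + g x) \<in> bump_algebra"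
| mult: "f \<in> bump_algebra \<Longrightarrow> g \<in> bump_algebra \<Longrightarrow> (\<lambda>x. f x * g x) \<in> bump_algebra"

lemma bump_affine_has_derivative:
  "((\<lambda>x::real^2. bump p (\<alpha> \<bullet> x + \<beta>)) has_derivative
     (\<lambda>h. (\<alpha> \<bullet> h) * bump (monom 1 2 * (p - pderiv p)) (\<alpha> \<bullet> x + \<beta>))) (at x)"
proof -
  have "((\<lambda>x::real^2. \<alpha> \<bullet> x + \<beta>) has_derivative (\<lambda>h. \<alpha> \<bullet> h)) (at x)"
    by (auto intro!: derivative_eq_intros)
  from has_derivative_compose[OF this bump_has_derivative[unfolded has_field_derivative_def]]
  show ?thesis by (simp add: mult.commute)
qed

text \<open>Differentiability and the partial derivatives go through the induction together, since
  the partial derivatives of a sum or product are only computable once its parts are known to be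
  differentiable.\<close>

lemma bump_algebra_deriv:
  assumes "f \<in> bump_algebra"
  shows "\<exists>g. (\<forall>i. g i \<in> bump_algebra) \<and> (\<forall>x. (f has_derivative (\<lambda>h. \<Sum>i\<in>UNIV. g i x * h $ i)) (at x))"
  using assms
proof induction
  case (bump p \<alpha> \<beta>)
  have "(\<lambda>x. \<alpha> $ i * bump (monom 1 2 * (p - pderiv p)) (\<alpha> \<bullet> x + \<beta>)) \<in> bump_algebra" for i
    by (intro bump_algebra.intros)
  moreover have "((\<lambda>x. bump p (\<alpha> \<bullet> x + \<beta>)) has_derivative
      (\<lambda>h. \<Sum>i\<in>UNIV. \<alpha> $ i * bump (monom 1 2 * (p - pderiv p)) (\<alpha> \<bullet> x + \<beta>) * h $ i)) (at x)" for x
    using bump_affine_has_derivative[of p \<alpha> \<beta> x]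
    by (simp add: inner_vec_def sum_2 algebra_simps)
  ultimately show ?case
    by (intro exI[of _ "\<lambda>i x. \<alpha> $ i * bump (monom 1 2 * (p - pderiv p)) (\<alpha> \<bullet> x + \<beta>)"]) auto
next
  case (scale f c)
  then obtain g where g: "\<And>i. g i \<in> bump_algebra"
    "\<And>x. (f has_derivative (\<lambda>h. \<Sum>i\<in>UNIV. g i x * h $ i)) (at x)" by auto
  have "((\<lambda>x. c * f x) has_derivative (\<lambda>h. \<Sum>i\<in>UNIV. (c * g i x) * h $ i)) (at x)" for x
    using has_derivative_mult_right[OF g(2), of c x] by (simp add: sum_2 algebra_simps)
  then show ?case using g(1) bump_algebra.scale by (intro exI[of _ "\<lambda>i x. c * g i x"]) auto
next
  case (add f1 f2)
  then obtain g1 g2 where g: "\<And>i. g1 i \<in> bump_algebra" "\<And>i. g2 i \<in> bump_algebra"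
    "\<And>x. (f1 has_derivative (\<lambda>h. \<Sum>i\<in>UNIV. g1 i x * h $ i)) (at x)"
    "\<And>x. (f2 has_derivative (\<lambda>h. \<Sum>i\<in>UNIV. g2 i x * h $ i)) (at x)" by auto
  have "((\<lambda>x. f1 x + f2 x) has_derivative (\<lambda>h. \<Sum>i\<in>UNIV. (g1 i x + g2 i x) * h $ i)) (at x)" for x
    using has_derivative_add[OF g(3)[of x] g(4)[of x]] by (simp add: sum_2 algebra_simps)
  then show ?case using g(1,2) bump_algebra.add by (intro exI[of _ "\<lambda>i x. g1 i x + g2 i x"]) auto
next
  case (mult f1 f2)
  then obtain g1 g2 where g: "\<And>i. g1 i \<in> bump_algebra" "\<And>i. g2 i \<in> bump_algebra"
    "\<And>x. (f1 has_derivative (\<lambda>h. \<Sum>i\<in>UNIV. g1 i x * h $ i)) (at x)"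
    "\<And>x. (f2 has_derivative (\<lambda>h. \<Sum>i\<in>UNIV. g2 i x * h $ i)) (at x)" by auto
  have "((\<lambda>x. f1 x * f2 x) has_derivative (\<lambda>h. \<Sum>i\<in>UNIV. (f1 x * g2 i x + g1 i x * f2 x) * h $ i)) (at x)" for x
    using has_derivative_mult[OF g(3)[of x] g(4)[of x]] by (simp add: sum_2 algebra_simps)
  then show ?case using g(1,2) mult.hyps bump_algebra.add bump_algebra.mult
    by (intro exI[of _ "\<lambda>i x. f1 x * g2 i x + g1 i x * f2 x"]) auto
qed

lemma bump_algebra_smooth:
  assumes "f \<in> bump_algebra"
  shows "f differentiable (at x)" "pd i f \<in> bump_algebra"
proof -
  obtain g where g: "\<And>i. g i \<in> bump_algebra"
    "\<And>x. (f has_derivative (\<lambda>h. \<Sum>i\<in>UNIV. g i x * h $ i)) (at x)"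
    using bump_algebra_deriv[OF assms] by auto
  show "f differentiable (at x)" using g(2) by (auto simp: differentiable_def)
  have "pd i f = g i"
    by (rule ext, subst pd_eqI[OF g(2)]) (simp add: axis_def if_distrib cong: if_cong)
  then show "pd i f \<in> bump_algebra" using g(1) by simp
qed

lemma bump_algebra_foldr_pd: "f \<in> bump_algebra \<Longrightarrow> foldr pd is f \<in> bump_algebra"
  by (induction "is") (auto intro: bump_algebra_smooth)

lemma bump_algebra_test_function:
  assumes f: "f \<in> bump_algebra" and C: "compact C" "C \<subseteq> U" "\<And>x. x \<notin> C \<Longrightarrow> f x = 0"
  shows "f \<in> test_functions U"
proof -
  have sub: "closure {x. f x \<noteq> 0} \<subseteq> C"
    by (rule closure_minimal) (use C in \<open>auto intro: compact_imp_closed\<close>)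
  moreover have "compact (closure {x. f x \<noteq> 0})"
    using sub C(1) by (metis bounded_subset compact_imp_bounded closed_closure compact_eq_bounded_closed)
  ultimately show ?thesis
    using C bump_algebra_smooth(1)[OF bump_algebra_foldr_pd[OF f]]
    by (auto simp: test_functions_def differentiable_on_def intro: differentiable_at_withinI)
qed

text \<open>One compact set serves all iterated derivatives, because partial derivatives vanish
  wherever the function vanishes off a closed set. The lists \<open>[]\<close>, \<open>[i]\<close>,
  \<open>[i, i]\<close> later select the function and its derivatives.\<close>

lemma test_functionD:
  assumes "\<phi> \<in> test_functions U"
  obtains C where "compact C" "C \<subseteq> U" "\<And>is x. x \<notin> C \<Longrightarrow> foldr pd is \<phi> x = 0"
    "\<And>is x. foldr pd is \<phi> differentiable (at x)" "\<And>is. continuous_on UNIV (foldr pd is \<phi>)"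
proof
  let ?C = "closure {x. \<phi> x \<noteq> 0}"
  show "compact ?C" "?C \<subseteq> U" using assms by (auto simp: test_functions_def)
  show d: "foldr pd is \<phi> differentiable (at x)" for "is" x
    using assms by (auto simp: test_functions_def differentiable_on_def)
  show "continuous_on UNIV (foldr pd is \<phi>)" for "is"
    using d by (simp add: differentiable_imp_continuous_within continuous_at_imp_continuous_on)
  show "foldr pd is \<phi> x = 0" if "x \<notin> ?C" for "is" x
    using that
  proof (induction "is" arbitrary: x)
    case Nil
    then show ?case using closure_subset[of "{x. \<phi> x \<noteq> 0}"] by auto
  next
    case (Cons i "is")
    show ?case using pd_0_outside[OF closed_closure Cons.IH Cons.prems] by simp
  qed
qed

section \<open>Integration by parts\<close>

text \<open>Fubini with the inner integral along direction \<open>i\<close>: on each such line the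
  fundamental theorem leaves two end values beyond the support, which are 0.\<close>

lemma integral_pd_eq_0:
  assumes F: "\<And>x. F differentiable (at x)" and cont: "continuous_on UNIV (pd i F)"
    and C: "compact C" "\<And>x. x \<notin> C \<Longrightarrow> F x = 0"
  shows "(\<integral>x. pd i F x \<partial>lborel) = 0"
proof -
  obtain j :: 2 where ij: "j \<noteq> i" using exhaust_2[of i] by (metis zero_neq_one one_neq_zero)
  \<comment> \<open>The first product coordinate runs along axis \<open>i\<close>, so it is the
    variable of the inner integral.\<close>
  define p q :: "real^2" where "p = axis i 1" and "q = axis j 1"
  have D: "cross2 p q \<noteq> 0"
    using ij exhaust_2[of i] exhaust_2[of j] by (auto simp: cross2_def p_def q_def axis_def)
  have bor: "pd i F \<in> borel_measurable borel" using cont by (rule borel_measurable_continuous_onI)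
  have zero: "pd i F x = 0" if "x \<notin> C" for x
    using pd_0_outside[OF compact_imp_closed[OF C(1)] C(2) that] .
  obtain R where R: "R > 0" "\<And>x. x \<in> C \<Longrightarrow> norm x < R"
    using compact_imp_bounded[OF C(1)] by (auto simp: bounded_pos_less)
  define G where "G y = pd i F (0 + fst y *\<^sub>R p + snd y *\<^sub>R q)" for y :: "real \<times> real"
  have "integrable lborel (pd i F)"
  proof -
    have "integrable lborel (\<lambda>x. indicator C x *\<^sub>R pd i F x)"
      by (rule borel_integrable_compact[OF C(1) continuous_on_subset[OF cont]]) simp
    moreover have "(\<lambda>x. indicator C x *\<^sub>R pd i F x) = pd i F"
      using zero by (force simp: indicator_def)
    ultimately show ?thesis by simp
  qed
  then have "integrable lborel G"
    unfolding G_def by (simp only: integrable_affine_param[OF D bor])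
  then have intG: "integrable (lborel \<Otimes>\<^sub>M lborel) (case_prod (\<lambda>s t. G (s, t)))"
    by (simp add: lborel_prod)
  have inner: "(\<integral>s. G (s, t) \<partial>lborel) = 0" for t
  proof -
    define f where "f s = F (s *\<^sub>R p + t *\<^sub>R q)" for s
    have der: "(f has_real_derivative G (s, t)) (at s)" for s
    proof -
      have "((\<lambda>s. s *\<^sub>R p + t *\<^sub>R q) has_derivative (\<lambda>h. h *\<^sub>R p)) (at s)"
        by (auto intro!: derivative_eq_intros)
      from has_derivative_compose[OF this has_derivative_pd[OF F]]
      have "(f has_derivative (\<lambda>h. \<Sum>k\<in>UNIV. pd k F (s *\<^sub>R p + t *\<^sub>R q) * (h *\<^sub>R p) $ k)) (at s)"
        by (simp add: f_def[abs_def])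
      moreover have "(\<Sum>k\<in>UNIV. pd k F (s *\<^sub>R p + t *\<^sub>R q) * (h *\<^sub>R p) $ k) = G (s, t) * h" for h
        using exhaust_2[of i] by (auto simp: sum_2 p_def axis_def G_def)
      ultimately show ?thesis by (simp add: has_field_derivative_def)
    qed
    have contG: "isCont (\<lambda>s. G (s, t)) s" for s
    proof -
      have "continuous_on UNIV (\<lambda>s. pd i F (0 + s *\<^sub>R p + t *\<^sub>R q))"
        by (rule continuous_on_compose2[OF cont]) (auto intro!: continuous_intros)
      then show ?thesis by (simp add: G_def continuous_on_eq_continuous_at)
    qed
    have out: "s *\<^sub>R p + t *\<^sub>R q \<notin> C" if "\<bar>s\<bar> \<ge> R" for s
    proof
      assume "s *\<^sub>R p + t *\<^sub>R q \<in> C"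
      then have "norm (s *\<^sub>R p + t *\<^sub>R q) < R" by (rule R(2))
      moreover have "\<bar>(s *\<^sub>R p + t *\<^sub>R q) $ i\<bar> \<le> norm (s *\<^sub>R p + t *\<^sub>R q)" by (rule component_le_norm_cart)
      moreover have "(s *\<^sub>R p + t *\<^sub>R q) $ i = s" using ij by (simp add: p_def q_def axis_def)
      ultimately show False using that by simp
    qed
    have "(\<integral>s. G (s, t) * indicator {-R..R} s \<partial>lborel) = f R - f (- R)"
      by (rule integral_FTC_Icc_real) (use R der contG in auto)
    moreover have "(\<lambda>s. G (s, t) * indicator {-R..R} s) = (\<lambda>s. G (s, t))"
    proof
      fix s
      show "G (s, t) * indicator {-R..R} s = G (s, t)"
        using out[of s] zero by (cases "\<bar>s\<bar> \<ge> R") (auto simp: G_def indicator_def)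
    qed
    moreover have "f R = 0" "f (- R) = 0"
      using out[of R] out[of "-R"] R(1) C(2) by (auto simp: f_def)
    ultimately show ?thesis by simp
  qed
  have "(\<integral>x. pd i F x \<partial>lborel) = \<bar>cross2 p q\<bar> * (\<integral>y. G y \<partial>lborel)"
    unfolding G_def by (rule integral_affine_param[OF D bor])
  also have "(\<integral>y. G y \<partial>lborel) = (\<integral>y. case_prod (\<lambda>s t. G (s, t)) y \<partial>(lborel \<Otimes>\<^sub>M lborel))"
    by (simp add: lborel_prod)
  also have "\<dots> = (\<integral>t. (\<integral>s. G (s, t) \<partial>lborel) \<partial>lborel)"
    using lborel_pair.integral_snd[OF intG] by simp
  also have "\<dots> = 0" by (simp add: inner)
  finally show ?thesis by simp
qed

text \<open>The open sets \<open>U\<close> and \<open>- C\<close> cover the plane; the extension is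
  \<open>h\<close> on the first and 0 on the second.\<close>

lemma continuous_on_zero_extension:
  assumes "open U" "continuous_on U h" "closed C" "C \<subseteq> U" "\<And>x. x \<in> U \<Longrightarrow> x \<notin> C \<Longrightarrow> h x = 0"
  shows "continuous_on UNIV (\<lambda>x. if x \<in> U then h x else (0::real))"
proof -
  have "continuous_on U (\<lambda>x. if x \<in> U then h x else 0)"
    using assms(2) by (rule continuous_on_eq) simp
  moreover have "continuous_on (- C) (\<lambda>x. if x \<in> U then h x else 0)"
    by (rule continuous_on_eq[OF continuous_on_const[of _ 0]]) (use assms(5) in auto)
  ultimately have "continuous_on (U \<union> - C) (\<lambda>x. if x \<in> U then h x else 0)"
    using assms(1,3) by (intro continuous_on_open_Un) auto
  moreover have "U \<union> - C = UNIV" using assms(4) by auto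
  ultimately show ?thesis by simp
qed

text \<open>Weak derivatives are tested on \<open>lebesgue_on U\<close>, whereas Fubini and the
  change of variables work with \<open>lborel\<close>. The zero extension is continuous, hence
  Borel, so completing the measure does not change its integral.\<close>

lemma compactly_supported_integral:
  fixes h :: "real^2 \<Rightarrow> real"
  assumes "open U" "continuous_on U h" "compact C" "C \<subseteq> U" "\<And>x. x \<in> U \<Longrightarrow> x \<notin> C \<Longrightarrow> h x = 0"
  shows "integrable (lebesgue_on U) h"
    and "integrable lborel (\<lambda>x. if x \<in> U then h x else 0)"
    and "(LINT x|lebesgue_on U. h x) = (\<integral>x. (if x \<in> U then h x else 0) \<partial>lborel)"
proof -
  let ?h = "\<lambda>x. if x \<in> U then h x else 0"
  have cont: "continuous_on UNIV ?h"
    using continuous_on_zero_extension assms compact_imp_closed by blast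
  then have bor: "?h \<in> borel_measurable lborel" by (simp add: borel_measurable_continuous_onI)
  have "integrable lborel (\<lambda>x. indicator C x *\<^sub>R ?h x)"
    by (rule borel_integrable_compact[OF assms(3) continuous_on_subset[OF cont]]) simp
  moreover have "(\<lambda>x. indicator C x *\<^sub>R ?h x) = ?h"
    using assms(5) by (force simp: indicator_def)
  ultimately show i: "integrable lborel ?h" by simp
  have U: "U \<inter> space lebesgue \<in> sets lebesgue" using assms(1) by auto
  have e: "(\<lambda>x. indicator U x *\<^sub>R h x) = ?h" by (auto simp: indicator_def)
  show "integrable (lebesgue_on U) h"
    unfolding integrable_restrict_space[OF U] e using i integrable_completion[OF bor] by simp
  show "(LINT x|lebesgue_on U. h x) = (\<integral>x. ?h x \<partial>lborel)"
    unfolding integral_restrict_space[OF U] e using integral_completion[OF bor] by simp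
qed

text \<open>The zero extension of \<open>f * \<phi>\<close> is a C1 function on the plane with
  compact support, so its partial derivative integrates to 0. Nothing is asked of \<open>f\<close>
  near the boundary of \<open>U\<close>, as \<open>\<phi>\<close> vanishes there.\<close>

lemma integration_by_parts:
  assumes U: "open U" and f: "\<And>x. x \<in> U \<Longrightarrow> f differentiable (at x)" "continuous_on U (pd i f)"
    and \<phi>: "\<And>x. \<phi> differentiable (at x)" "continuous_on UNIV (pd i \<phi>)"
    and C: "compact C" "C \<subseteq> U" "\<And>x. x \<notin> C \<Longrightarrow> \<phi> x = 0"
  shows "(LINT x|lebesgue_on U. f x * pd i \<phi> x) = - (LINT x|lebesgue_on U. pd i f x * \<phi> x)"
proof -
  define F where "F x = (if x \<in> U then f x * \<phi> x else 0)" for x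
  have cC: "closed C" using C(1) by (rule compact_imp_closed)
  have zero: "pd i \<phi> x = 0" if "x \<notin> C" for x
    using pd_0_outside[OF cC C(3) that] .
  have cf: "continuous_on U f"
    using f(1) by (simp add: differentiable_imp_continuous_within continuous_at_imp_continuous_on)
  have c\<phi>: "continuous_on U \<phi>"
    using \<phi>(1) by (simp add: differentiable_imp_continuous_within continuous_at_imp_continuous_on)
  have in_U: "(F has_derivative (\<lambda>h. f x * (\<Sum>i\<in>UNIV. pd i \<phi> x * h $ i) + (\<Sum>i\<in>UNIV. pd i f x * h $ i) * \<phi> x)) (at x)"
    if "x \<in> U" for x
    using has_derivative_mult[OF has_derivative_pd[OF f(1)[OF that]] has_derivative_pd[OF \<phi>(1)]]
    by (rule has_derivative_transform_within_open[OF _ U that]) (simp add: F_def)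
  have out: "(F has_derivative (\<lambda>h. 0)) (at x)" if "x \<notin> U" for x
    by (rule has_derivative_transform_within_open[OF has_derivative_const, of "- C"])
       (use that C cC in \<open>auto simp: F_def\<close>)
  have diff: "F differentiable (at x)" for x
    using in_U[of x] out[of x] by (cases "x \<in> U") (auto simp: differentiable_def)
  have pdF: "pd i F = (\<lambda>x. if x \<in> U then f x * pd i \<phi> x + pd i f x * \<phi> x else 0)"
  proof
    fix x
    show "pd i F x = (if x \<in> U then f x * pd i \<phi> x + pd i f x * \<phi> x else 0)"
      using pd_eqI[OF in_U, of x i] pd_eqI[OF out, of x i] exhaust_2[of i]
      by (auto simp: sum_2 axis_def)
  qed
  have c1: "continuous_on U (\<lambda>x. f x * pd i \<phi> x)" and c2: "continuous_on U (\<lambda>x. pd i f x * \<phi> x)"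
    by (intro continuous_intros cf c\<phi> f(2) continuous_on_subset[OF \<phi>(2)]; simp)+
  have "continuous_on UNIV (pd i F)"
    unfolding pdF
    by (rule continuous_on_zero_extension[OF U _ cC C(2)])
       (use c1 c2 zero C(3) in \<open>auto intro: continuous_on_add\<close>)
  then have "(\<integral>x. pd i F x \<partial>lborel) = 0"
    by (rule integral_pd_eq_0[OF diff _ C(1)]) (use C(3) in \<open>auto simp: F_def\<close>)
  note s1 = compactly_supported_integral[OF U c1 C(1,2)] and s2 = compactly_supported_integral[OF U c2 C(1,2)]
  have "(\<integral>x. pd i F x \<partial>lborel) = (\<integral>x. (if x \<in> U then f x * pd i \<phi> x else 0) + (if x \<in> U then pd i f x * \<phi> x else 0) \<partial>lborel)"
    unfolding pdF by (rule Bochner_Integration.integral_cong) auto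
  also have "\<dots> = (\<integral>x. (if x \<in> U then f x * pd i \<phi> x else 0) \<partial>lborel) + (\<integral>x. (if x \<in> U then pd i f x * \<phi> x else 0) \<partial>lborel)"
    by (rule Bochner_Integration.integral_add) (use s1(2) s2(2) zero C(3) in auto)
  also have "\<dots> = (LINT x|lebesgue_on U. f x * pd i \<phi> x) + (LINT x|lebesgue_on U. pd i f x * \<phi> x)"
    using s1(3) s2(3) zero C(3) by simp
  finally have "(LINT x|lebesgue_on U. f x * pd i \<phi> x) + (LINT x|lebesgue_on U. pd i f x * \<phi> x)
     = (\<integral>x. pd i F x \<partial>lborel)" by simp
  then show ?thesis using \<open>(\<integral>x. pd i F x \<partial>lborel) = 0\<close> by simp
qed

section \<open>Weak derivatives\<close>

lemma test_functions_mono: "V \<subseteq> U \<Longrightarrow> test_functions V \<subseteq> test_functions U"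
  unfolding test_functions_def by auto

lemma locally_integrable_cong:
  assumes "\<And>x. x \<in> U \<Longrightarrow> f x = g x"
  shows "locally_integrable U f \<longleftrightarrow> locally_integrable U g"
proof -
  have "integrable (lebesgue_on C) f \<longleftrightarrow> integrable (lebesgue_on C) g" if "C \<subseteq> U" for C
    by (rule Bochner_Integration.integrable_cong[OF refl]) (use that assms in auto)
  then show ?thesis unfolding locally_integrable_def by auto
qed

lemma continuous_locally_integrable: "continuous_on U f \<Longrightarrow> locally_integrable U f"
  unfolding locally_integrable_def
proof (intro allI impI)
  fix C assume f: "continuous_on U f" and C: "compact C \<and> C \<subseteq> U"
  have sC: "C \<inter> space lebesgue \<in> sets lebesgue" using compact_imp_closed[of C] C by auto
  have "integrable lborel (\<lambda>x. indicator C x *\<^sub>R f x)"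
    using f C by (intro borel_integrable_compact) (auto intro: continuous_on_subset)
  then show "integrable (lebesgue_on C) f"
    unfolding integrable_restrict_space[OF sC]
    by (simp only: integrable_completion borel_measurable_integrable)
qed

lemma integrable_times_compactly_supported:
  assumes f: "locally_integrable U f" and U: "open U"
    and \<psi>: "continuous_on UNIV \<psi>" and C: "compact C" "C \<subseteq> U" "\<And>x. x \<notin> C \<Longrightarrow> \<psi> x = 0"
  shows "integrable (lebesgue_on U) (\<lambda>x. f x * \<psi> x)"
proof -
  have sU: "U \<inter> space lebesgue \<in> sets lebesgue" and sC: "C \<inter> space lebesgue \<in> sets lebesgue"
    using U compact_imp_closed[OF C(1)] by auto
  have "integrable lebesgue (\<lambda>x. indicator C x *\<^sub>R f x)"
    using f C(1,2) integrable_restrict_space[OF sC, of f] by (simp add: locally_integrable_def)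
  moreover obtain M where M: "\<And>x. \<bar>\<psi> x\<bar> \<le> M"
  proof -
    have "compact (\<psi> ` C)" using C(1) \<psi> by (meson compact_continuous_image continuous_on_subset subset_UNIV)
    then obtain M where "M > 0" "\<And>x. x \<in> C \<Longrightarrow> \<bar>\<psi> x\<bar> \<le> M"
      using compact_imp_bounded bounded_pos by (metis imageI real_norm_def)
    then have "\<bar>\<psi> x\<bar> \<le> M" for x using C(3)[of x] by (cases "x \<in> C") auto
    then show ?thesis using that by blast
  qed
  moreover have "\<psi> \<in> borel_measurable lebesgue"
    using \<psi> by (simp add: borel_measurable_continuous_onI measurable_completion)
  ultimately have "integrable lebesgue (\<lambda>x. (indicator C x *\<^sub>R f x) * \<psi> x)"
    by (intro Bochner_Integration.integrable_bound[where g = "(\<lambda>x. (indicator C x *\<^sub>R f x) * \<psi> x)"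
          and f = "\<lambda>x. M * (indicator C x *\<^sub>R f x)"])
       (auto intro!: AE_I2 mult_left_mono simp: abs_mult mult.commute[of M] intro: order_trans[OF _ abs_ge_self])
  moreover have "(\<lambda>x. (indicator C x *\<^sub>R f x) * \<psi> x) = (\<lambda>x. indicator U x *\<^sub>R (f x * \<psi> x))"
    using C(2,3) by (force simp: indicator_def)
  ultimately show ?thesis unfolding integrable_restrict_space[OF sU] by simp
qed

text \<open>Test functions on \<open>V\<close> are test functions on \<open>U\<close>, and their
  support in \<open>V\<close> makes both integrals agree. Used to bring functions from H^2 of the
  domain down to one triangle.\<close>

lemma is_weak_deriv_restrict:
  assumes "is_weak_deriv U is f g" "V \<subseteq> U" "open U" "open V"
  shows "is_weak_deriv V is f g"
proof -
  have sU: "U \<inter> space lebesgue \<in> sets lebesgue" and sV: "V \<inter> space lebesgue \<in> sets lebesgue"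
    using assms by auto
  have eq: "(LINT x|lebesgue_on U. h x * foldr pd js \<phi> x) = (LINT x|lebesgue_on V. h x * foldr pd js \<phi> x)"
    if \<phi>: "\<phi> \<in> test_functions V" for \<phi> h js
  proof -
    obtain C where C: "C \<subseteq> V" "\<And>is x. x \<notin> C \<Longrightarrow> foldr pd is \<phi> x = 0"
      by (rule test_functionD[OF \<phi>]) (rule that)
    then have "(\<lambda>x. indicator U x *\<^sub>R (h x * foldr pd js \<phi> x)) = (\<lambda>x. indicator V x *\<^sub>R (h x * foldr pd js \<phi> x))"
      using assms(2) by (force simp: indicator_def)
    then show ?thesis unfolding integral_restrict_space[OF sU] integral_restrict_space[OF sV] by simp
  qed
  have "locally_integrable V f" "locally_integrable V g"
    using assms(1,2) unfolding is_weak_deriv_def locally_integrable_def by auto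
  moreover have "(LINT x|lebesgue_on V. f x * foldr pd is \<phi> x) = (-1) ^ length is * (LINT x|lebesgue_on V. g x * \<phi> x)"
    if "\<phi> \<in> test_functions V" for \<phi>
    using assms(1) eq[OF that, of f "is"] eq[OF that, of g "[]"] test_functions_mono[OF assms(2)] that
    unfolding is_weak_deriv_def by auto
  ultimately show ?thesis unfolding is_weak_deriv_def by blast
qed

lemma is_weak_deriv_cong:
  assumes "is_weak_deriv U is f g" "\<And>x. x \<in> U \<Longrightarrow> f x = f' x" "open U"
  shows "is_weak_deriv U is f' g"
proof -
  have "(LINT x|lebesgue_on U. f' x * h x) = (LINT x|lebesgue_on U. f x * h x)" for h
    by (rule Bochner_Integration.integral_cong) (use assms(2) in auto)
  then show ?thesis
    using assms(1) locally_integrable_cong[of U f f', OF assms(2)] unfolding is_weak_deriv_def by simp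
qed

text \<open>The point is integrability of each product with a test function, without which the
  integral of the sum could not be split; local integrability and compact support give it.\<close>

lemma is_weak_deriv_lincomb:
  assumes f: "is_weak_deriv U is f1 g1" "is_weak_deriv U is f2 g2" and U: "open U"
  shows "is_weak_deriv U is (\<lambda>x. a * f1 x + b * f2 x) (\<lambda>x. a * g1 x + b * g2 x)"
proof -
  have li: "locally_integrable U (\<lambda>x. a * h1 x + b * h2 x)"
    if "locally_integrable U h1" "locally_integrable U h2" for h1 h2
    using that unfolding locally_integrable_def by auto
  have split: "(LINT x|lebesgue_on U. (a * h1 x + b * h2 x) * foldr pd js \<phi> x) =
      a * (LINT x|lebesgue_on U. h1 x * foldr pd js \<phi> x) + b * (LINT x|lebesgue_on U. h2 x * foldr pd js \<phi> x)"
    if h: "locally_integrable U h1" "locally_integrable U h2" and \<phi>: "\<phi> \<in> test_functions U" for h1 h2 js \<phi>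
  proof -
    obtain C where C: "compact C" "C \<subseteq> U" "\<And>is x. x \<notin> C \<Longrightarrow> foldr pd is \<phi> x = 0"
      and cont: "\<And>is. continuous_on UNIV (foldr pd is \<phi>)"
      using test_functionD[OF \<phi>] by metis
    note i = integrable_times_compactly_supported[OF _ U cont C(1,2) C(3)]
    have "(\<lambda>x. (a * h1 x + b * h2 x) * foldr pd js \<phi> x) =
        (\<lambda>x. a * (h1 x * foldr pd js \<phi> x) + b * (h2 x * foldr pd js \<phi> x))"
      by (auto simp: algebra_simps)
    then show ?thesis using i[OF h(1), of js] i[OF h(2), of js] by simp
  qed
  show ?thesis
    unfolding is_weak_deriv_def
  proof (intro conjI ballI)
    show "locally_integrable U (\<lambda>x. a * f1 x + b * f2 x)" "locally_integrable U (\<lambda>x. a * g1 x + b * g2 x)"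
      using f li unfolding is_weak_deriv_def by auto
    fix \<phi> assume \<phi>: "\<phi> \<in> test_functions U"
    show "(LINT x|lebesgue_on U. (a * f1 x + b * f2 x) * foldr pd is \<phi> x) =
        (-1) ^ length is * (LINT x|lebesgue_on U. (a * g1 x + b * g2 x) * \<phi> x)"
      using f \<phi> split[of f1 f2 \<phi> "is"] split[of g1 g2 \<phi> "[]"]
      unfolding is_weak_deriv_def by (simp add: distrib_left mult.left_commute)
  qed
qed

lemma is_weak_deriv_zero: "open U \<Longrightarrow> is_weak_deriv U is (\<lambda>_. 0) (\<lambda>_. 0)"
  unfolding is_weak_deriv_def by (auto simp: locally_integrable_def)

lemma weak_deriv_exists_sum:
  assumes "finite E" "open U" "\<And>e. e \<in> E \<Longrightarrow> \<exists>g. is_weak_deriv U is (f e) g"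
  shows "\<exists>g. is_weak_deriv U is (\<lambda>x. \<Sum>e\<in>E. c e * f e x) g"
  using assms(1,3)
proof (induction rule: finite_induct)
  case empty
  then show ?case using is_weak_deriv_zero[OF assms(2)] by auto
next
  case (insert e E)
  then obtain g1 g2 where "is_weak_deriv U is (f e) g1" "is_weak_deriv U is (\<lambda>x. \<Sum>e\<in>E. c e * f e x) g2"
    by (metis insertI1 insertI2)
  from is_weak_deriv_lincomb[OF this assms(2), of "c e" 1] show ?case
    using insert.hyps by auto
qed

text \<open>Two classical integrations by parts; this serves the quadratic that represents a Morley
  function on a triangle.\<close>

lemma is_weak_deriv_classical:
  assumes U: "open U" and f: "\<And>x. f differentiable (at x)" "\<And>x. pd i f differentiable (at x)"
    "continuous_on UNIV (pd i (pd i f))"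
  shows "is_weak_deriv U [i, i] f (pd i (pd i f))"
  unfolding is_weak_deriv_def
proof (intro conjI ballI)
  have cont: "continuous_on UNIV f" "continuous_on UNIV (pd i f)"
    using f by (simp_all add: differentiable_imp_continuous_within continuous_at_imp_continuous_on)
  show "locally_integrable U f" "locally_integrable U (pd i (pd i f))"
    using cont(1) f(3) by (meson continuous_locally_integrable continuous_on_subset subset_UNIV)+
  fix \<phi> assume "\<phi> \<in> test_functions U"
  from test_functionD[OF this] obtain C where C: "compact C" "C \<subseteq> U" "\<And>is x. x \<notin> C \<Longrightarrow> foldr pd is \<phi> x = 0"
    and \<phi>: "\<And>is x. foldr pd is \<phi> differentiable (at x)" "\<And>is. continuous_on UNIV (foldr pd is \<phi>)" by metis
  have "(LINT x|lebesgue_on U. f x * pd i (pd i \<phi>) x) = - (LINT x|lebesgue_on U. pd i f x * pd i \<phi> x)"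
    using \<phi>(1)[of "[i]"] \<phi>(2)[of "[i,i]"] C(3)[of _ "[i]"] cont(2)
    by (intro integration_by_parts[OF U f(1) _ _ _ C(1,2)]) (auto intro: continuous_on_subset)
  also have "(LINT x|lebesgue_on U. pd i f x * pd i \<phi> x) = - (LINT x|lebesgue_on U. pd i (pd i f) x * \<phi> x)"
    using \<phi>(1)[of "[]"] \<phi>(2)[of "[i]"] C(3)[of _ "[]"] f(3)
    by (intro integration_by_parts[OF U f(2) _ _ _ C(1,2)]) (auto intro: continuous_on_subset)
  finally show "(LINT x|lebesgue_on U. f x * foldr pd [i, i] \<phi> x) =
      (- 1) ^ length [i, i] * (LINT x|lebesgue_on U. pd i (pd i f) x * \<phi> x)" by simp
qed

text \<open>If the weak Laplacian is not integrable, its Bochner integral is \<open>0\<close> by convention.\<close>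

lemma integral_wlaplacian_eq_0:
  assumes U: "open U" and w: "\<And>x. x \<in> U \<Longrightarrow> w differentiable (at x)" "\<And>i. continuous_on U (pd i w)"
    and ex: "\<And>i. \<exists>g. is_weak_deriv U [i, i] w g"
    and \<phi>: "\<And>n::nat. \<phi> n \<in> test_functions U" "\<And>n x. \<bar>\<phi> n x\<bar> \<le> 1"
      "\<And>x. x \<in> U \<Longrightarrow> (\<lambda>n. \<phi> n x) \<longlonglongrightarrow> 1"
    and lim: "(\<lambda>n. LINT x|lebesgue_on U. grad w x \<bullet> grad (\<phi> n) x) \<longlonglongrightarrow> 0"
  shows "(LINT x|lebesgue_on U. wlaplacian U w x) = 0"
proof (cases "integrable (lebesgue_on U) (wlaplacian U w)")
  case False
  then show ?thesis using not_integrable_integral_eq by blast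
next
  case True
  define g where "g i = wderiv U [i, i] w" for i
  \<comment> \<open>Existence alone makes the selected function satisfy the defining
    identity.\<close>
  have g: "is_weak_deriv U [i, i] w (g i)" for i
    unfolding g_def wderiv_def by (rule someI_ex[OF ex])
  have G: "wlaplacian U w x = (\<Sum>i\<in>UNIV. g i x)" for x by (simp add: wlaplacian_def g_def)
  have step: "(LINT x|lebesgue_on U. wlaplacian U w x * \<phi> n x) = - (LINT x|lebesgue_on U. grad w x \<bullet> grad (\<phi> n) x)" for n
  proof -
    from test_functionD[OF \<phi>(1)[of n]] obtain C where C: "compact C" "C \<subseteq> U" "\<And>is x. x \<notin> C \<Longrightarrow> foldr pd is (\<phi> n) x = 0"
      and d: "\<And>is x. foldr pd is (\<phi> n) differentiable (at x)" "\<And>is. continuous_on UNIV (foldr pd is (\<phi> n))" by metis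
    have i1: "integrable (lebesgue_on U) (\<lambda>x. g i x * \<phi> n x)" for i
      using integrable_times_compactly_supported[OF _ U d(2)[of "[]"] C(1,2)] C(3)[of _ "[]"] g[of i]
      by (simp add: is_weak_deriv_def)
    have i2: "integrable (lebesgue_on U) (\<lambda>x. pd i w x * pd i (\<phi> n) x)" for i
    proof (rule compactly_supported_integral(1)[OF U _ C(1,2)])
      show "continuous_on U (\<lambda>x. pd i w x * pd i (\<phi> n) x)"
        using w(2)[of i] d(2)[of "[i]"] by (auto intro!: continuous_on_mult intro: continuous_on_subset)
      show "pd i w x * pd i (\<phi> n) x = 0" if "x \<notin> C" for x
        using C(3)[OF that, of "[i]"] by simp
    qed
    have "(LINT x|lebesgue_on U. wlaplacian U w x * \<phi> n x) = (\<Sum>i\<in>UNIV. LINT x|lebesgue_on U. g i x * \<phi> n x)"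
      unfolding G sum_distrib_right by (rule Bochner_Integration.integral_sum) (rule i1)
    \<comment> \<open>The weak identity puts both derivatives on \<open>\<phi> n\<close>; one of
      them is then moved back to \<open>w\<close> classically, for which C1 regularity of
      \<open>w\<close> in \<open>U\<close> suffices.\<close>
    also have "\<dots> = (\<Sum>i\<in>UNIV. LINT x|lebesgue_on U. w x * pd i (pd i (\<phi> n)) x)"
      using g \<phi>(1)[of n] by (intro sum.cong refl) (simp add: is_weak_deriv_def)
    also have "\<dots> = (\<Sum>i\<in>UNIV. - (LINT x|lebesgue_on U. pd i w x * pd i (\<phi> n) x))"
    proof (intro sum.cong refl)
      fix i
      show "(LINT x|lebesgue_on U. w x * pd i (pd i (\<phi> n)) x) = - (LINT x|lebesgue_on U. pd i w x * pd i (\<phi> n) x)"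
        using d(1)[of "[i]"] d(2)[of "[i,i]"] C(3)[of _ "[i]"] w(2)[of i]
        by (intro integration_by_parts[OF U w(1) _ _ _ C(1,2)]) auto
    qed
    also have "\<dots> = - (LINT x|lebesgue_on U. grad w x \<bullet> grad (\<phi> n) x)"
      using i2 by (simp add: sum_negf grad_def inner_vec_def)
    finally show ?thesis .
  qed
  \<comment> \<open>In this branch the weak Laplacian is integrable, so its absolute value dominates
    all products with the cut-offs.\<close>
  have "(\<lambda>n. LINT x|lebesgue_on U. wlaplacian U w x * \<phi> n x) \<longlonglongrightarrow> (LINT x|lebesgue_on U. wlaplacian U w x)"
  proof (rule integral_dominated_convergence[where w = "\<lambda>x. \<bar>wlaplacian U w x\<bar>"])
    show m: "wlaplacian U w \<in> borel_measurable (lebesgue_on U)" using True by simp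
    have "\<phi> n \<in> borel_measurable (lebesgue_on U)" for n
    proof -
      have "continuous_on UNIV (\<phi> n)" using test_functionD[OF \<phi>(1)[of n]] by (metis foldr.simps(1) id_apply)
      then show ?thesis
        by (simp add: borel_measurable_continuous_onI measurable_completion measurable_restrict_space1)
    qed
    then show "(\<lambda>x. wlaplacian U w x * \<phi> n x) \<in> borel_measurable (lebesgue_on U)" for n
      using m by simp
    show "integrable (lebesgue_on U) (\<lambda>x. \<bar>wlaplacian U w x\<bar>)" using True by simp
    show "AE x in lebesgue_on U. (\<lambda>n. wlaplacian U w x * \<phi> n x) \<longlonglongrightarrow> wlaplacian U w x"
      using tendsto_mult[OF tendsto_const \<phi>(3)] by (intro AE_I2) (auto simp: space_restrict_space)
    show "AE x in lebesgue_on U. norm (wlaplacian U w x * \<phi> n x) \<le> \<bar>wlaplacian U w x\<bar>" for n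
      using mult_left_mono[OF \<phi>(2)] by (intro AE_I2) (simp add: abs_mult mult_left_le)
  qed
  moreover have "(\<lambda>n. LINT x|lebesgue_on U. wlaplacian U w x * \<phi> n x) \<longlonglongrightarrow> 0"
    unfolding step using tendsto_minus[OF lim] by simp
  ultimately show ?thesis using LIMSEQ_unique by blast
qed

section \<open>Barycentric cut-offs of a triangle\<close>

text \<open>The shift by 1 makes \<open>cutoff (N * t)\<close> vanish on the whole strip
  \<open>t \<le> 1 / N\<close> and not just for \<open>t \<le> 0\<close>; this gives the product of
  the three cut-offs compact support in the open triangle.\<close>

definition cutoff :: "real \<Rightarrow> real" where
  "cutoff t = bump 1 (t - 1)"

definition cutoff_deriv :: "real \<Rightarrow> real" where
  "cutoff_deriv t = bump (monom 1 2) (t - 1)"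

lemma cutoff_eq_0: "t \<le> 1 \<Longrightarrow> cutoff t = 0" "t \<le> 1 \<Longrightarrow> cutoff_deriv t = 0"
  by (simp_all add: cutoff_def cutoff_deriv_def bump_def)

lemma cutoff_bounds: "0 \<le> cutoff t" "cutoff t \<le> 1" "0 \<le> cutoff_deriv t"
  by (auto simp: cutoff_def cutoff_deriv_def bump_def poly_monom)

lemma cutoff_has_derivative: "(cutoff has_real_derivative cutoff_deriv t) (at t)"
proof -
  have "((\<lambda>t. t - 1) has_real_derivative 1) (at t)" by (auto intro!: derivative_eq_intros)
  from DERIV_chain2[OF bump_has_derivative[of 1] this] show ?thesis
    by (simp add: cutoff_def[abs_def] cutoff_deriv_def pderiv_1)
qed

lemma cutoff_continuous: "continuous_on S cutoff" "continuous_on S cutoff_deriv"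
  unfolding cutoff_def cutoff_deriv_def
  by (intro continuous_on_compose2[OF bump_continuous[of UNIV]] continuous_intros; simp)+

lemma cutoff_continuous_intro [continuous_intros]:
  assumes "continuous_on S f"
  shows "continuous_on S (\<lambda>x. cutoff (f x))" "continuous_on S (\<lambda>x. cutoff_deriv (f x))"
  using continuous_on_compose2[OF cutoff_continuous(1)[of UNIV] assms]
    continuous_on_compose2[OF cutoff_continuous(2)[of UNIV] assms] by auto

lemma cutoff_tendsto_1: "(cutoff \<longlongrightarrow> 1) at_top"
proof -
  have "filterlim (\<lambda>t::real. t - 1) at_top at_top"
    using filterlim_tendsto_add_at_top[OF tendsto_const filterlim_ident, of "-1::real"] by simp
  then have "((\<lambda>t::real. exp (- (1 / (t - 1)))) \<longlongrightarrow> exp (- 0)) at_top"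
    by (intro tendsto_intros tendsto_divide_0[OF tendsto_const] filterlim_at_top_imp_at_infinity)
  moreover have "\<forall>\<^sub>F t in at_top. exp (- (1 / (t - 1))) = cutoff t"
    using eventually_gt_at_top[of "1::real"] by eventually_elim (simp add: cutoff_def bump_def)
  ultimately show ?thesis using Lim_transform_eventually by fastforce
qed

text \<open>A nonnegative derivative of a function that tends to 1 has finite mass. It is the
  profile of a layer across an edge and provides the dominating function there.\<close>

lemma integrable_cutoff_deriv: "integrable lborel cutoff_deriv"
proof -
  have b: "cutoff_deriv \<in> borel_measurable borel"
    using cutoff_continuous(2) by (rule borel_measurable_continuous_onI)
  have "(\<integral>\<^sup>+x. ennreal (cutoff_deriv x) * indicator {0..} x \<partial>lborel) = ennreal (1 - cutoff 0)"
    by (rule nn_integral_FTC_atLeast[OF b cutoff_has_derivative cutoff_bounds(3) cutoff_tendsto_1])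
  moreover have "(\<lambda>x. ennreal (cutoff_deriv x) * indicator {0..} x) = (\<lambda>x. ennreal (cutoff_deriv x))"
    by (auto simp: indicator_def cutoff_eq_0)
  ultimately show ?thesis
    by (intro integrableI_nonneg) (auto simp: b cutoff_bounds)
qed

text \<open>For a nondegenerate triangle, the barycentric coordinate of the vertex \<open>c\<close>:
  it is 0 on the line through \<open>a\<close> and \<open>b\<close> and 1 at \<open>c\<close>.
  Cyclic rotation of the arguments gives the coordinates of \<open>a\<close> and of
  \<open>b\<close>.\<close>

definition bary :: "real^2 \<Rightarrow> real^2 \<Rightarrow> real^2 \<Rightarrow> real^2 \<Rightarrow> real" where
  "bary a b c x = cross2 (b - a) (x - a) / cross2 (b - a) (c - a)"

text \<open>The edge vector \<open>b - a\<close> turned by a right angle and scaled, hence a normal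
  to the edge opposite \<open>c\<close>; it is the constant gradient of
  \<open>bary a b c\<close>.\<close>

definition bary_grad :: "real^2 \<Rightarrow> real^2 \<Rightarrow> real^2 \<Rightarrow> real^2" where
  "bary_grad a b c = (1 / cross2 (b - a) (c - a)) *\<^sub>R vector [- ((b - a) $ 2), (b - a) $ 1]"

text \<open>Both sides are twice the signed area of the same triangle. One nondegeneracy hypothesis
  thus serves all three edges.\<close>

lemma cross2_cyclic: "cross2 (c - b) (a - b) = cross2 (b - a) (c - a)"
  by (simp add: cross2_def algebra_simps)

lemma bary_affine: "bary a b c x = bary_grad a b c \<bullet> x + bary a b c 0"
proof -
  have "cross2 (b - a) (x - a) = vector [- ((b - a) $ 2), (b - a) $ 1] \<bullet> x + cross2 (b - a) (0 - a)"
    by (simp add: inner_vec_def sum_2 cross2_def algebra_simps)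
  then show ?thesis by (simp add: bary_def bary_grad_def add_divide_distrib)
qed

lemma bary_continuous [continuous_intros]:
  "continuous_on S f \<Longrightarrow> continuous_on S (\<lambda>x. bary a b c (f x))"
  by (subst bary_affine) (intro continuous_intros)

lemma bary_sum:
  assumes "cross2 (b - a) (c - a) \<noteq> 0"
  shows "bary a b c x + bary b c a x + bary c a b x = 1"
proof -
  have "bary a b c x + bary b c a x + bary c a b x =
     (cross2 (b - a) (x - a) + cross2 (c - b) (x - b) + cross2 (a - c) (x - c)) / cross2 (b - a) (c - a)"
    unfolding bary_def cross2_cyclic[of c b a] cross2_cyclic[of a c b] by (simp add: add_divide_distrib)
  also have "cross2 (b - a) (x - a) + cross2 (c - b) (x - b) + cross2 (a - c) (x - c) = cross2 (b - a) (c - a)"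
    by (simp add: cross2_def algebra_simps)
  finally show ?thesis using assms by simp
qed

lemma bary_param:
  assumes "cross2 (b - a) (c - a) \<noteq> 0"
  shows "bary a b c (a + s *\<^sub>R (b - a) + t *\<^sub>R (c - a)) = t"
    and "bary c a b (a + s *\<^sub>R (b - a) + t *\<^sub>R (c - a)) = s"
    and "bary b c a (a + s *\<^sub>R (b - a) + t *\<^sub>R (c - a)) = 1 - s - t"
proof -
  let ?x = "a + s *\<^sub>R (b - a) + t *\<^sub>R (c - a)"
  have "cross2 (b - a) (?x - a) = t * cross2 (b - a) (c - a)"
    by (simp add: cross2_def algebra_simps)
  then show 1: "bary a b c ?x = t" using assms by (simp add: bary_def)
  have "cross2 (a - c) (?x - c) = s * cross2 (b - a) (c - a)"
    by (simp add: cross2_def algebra_simps)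
  then show 2: "bary c a b ?x = s"
    using assms by (simp add: bary_def cross2_cyclic[of c b a] cross2_cyclic[of b a c])
  show "bary b c a ?x = 1 - s - t" using bary_sum[OF assms, of ?x] 1 2 by simp
qed

lemma bary_combination:
  assumes "cross2 (b - a) (c - a) \<noteq> 0"
  shows "a + bary c a b x *\<^sub>R (b - a) + bary a b c x *\<^sub>R (c - a) = x"
proof -
  have "bary c a b x = cross2 (x - a) (c - a) / cross2 (b - a) (c - a)"
    unfolding bary_def cross2_cyclic[of b a c] by (simp add: cross2_def algebra_simps)
  then show ?thesis
    unfolding bary_def[of a b c] add.assoc using cramer2[OF assms, of "x - a"] by simp
qed

text \<open>The triangle is the intersection of three half-planes. Interior commutes with finite
  intersections, and a nonzero gradient makes the interior of each half-plane the open one.\<close>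

lemma triangle_bary:
  assumes "cross2 (b - a) (c - a) \<noteq> 0"
  shows "convex hull {a, b, c} = {x. bary a b c x \<ge> 0 \<and> bary b c a x \<ge> 0 \<and> bary c a b x \<ge> 0}"
    and "interior (convex hull {a, b, c}) = {x. bary a b c x > 0 \<and> bary b c a x > 0 \<and> bary c a b x > 0}"
proof -
  show K: "convex hull {a, b, c} = {x. bary a b c x \<ge> 0 \<and> bary b c a x \<ge> 0 \<and> bary c a b x \<ge> 0}" (is "_ = ?K")
  proof (intro subset_antisym subsetI)
    fix x assume "x \<in> convex hull {a, b, c}"
    then obtain u v where uv: "x = a + u *\<^sub>R (b - a) + v *\<^sub>R (c - a)" "0 \<le> u" "0 \<le> v" "u + v \<le> 1"
      unfolding convex_hull_3_alt by auto
    then show "x \<in> ?K" using bary_param[OF assms, of u v] by simp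
  next
    fix x assume "x \<in> ?K"
    then show "x \<in> convex hull {a, b, c}"
      unfolding convex_hull_3_alt using bary_combination[OF assms, of x] bary_sum[OF assms, of x]
      by (intro CollectI exI[of _ "bary c a b x"] exI[of _ "bary a b c x"]) auto
  qed
  \<comment> \<open>With gradient 0 the coordinate would be constant, but it is 0 at the first
    vertex and 1 at the third.\<close>
  have grad_nz: "bary_grad a' b' c' \<noteq> 0" if "cross2 (b' - a') (c' - a') \<noteq> 0" for a' b' c'
  proof
    assume "bary_grad a' b' c' = 0"
    then have "bary a' b' c' c' = bary a' b' c' a'" by (metis bary_affine inner_zero_left)
    then show False using that by (simp add: bary_def cross2_def)
  qed
  have half: "interior {x. bary a' b' c' x \<ge> 0} = {x. bary a' b' c' x > 0}"
    if "cross2 (b' - a') (c' - a') \<noteq> 0" for a' b' c'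
  proof -
    have "{x. bary a' b' c' x \<ge> 0} = {x. bary_grad a' b' c' \<bullet> x \<ge> - bary a' b' c' 0}"
      "{x. bary a' b' c' x > 0} = {x. bary_grad a' b' c' \<bullet> x > - bary a' b' c' 0}"
      by (subst bary_affine; auto)+
    then show ?thesis using interior_halfspace_ge[OF grad_nz[OF that]] by simp
  qed
  have "?K = {x. bary a b c x \<ge> 0} \<inter> ({x. bary b c a x \<ge> 0} \<inter> {x. bary c a b x \<ge> 0})" by auto
  then show "interior (convex hull {a, b, c}) = {x. bary a b c x > 0 \<and> bary b c a x > 0 \<and> bary c a b x > 0}"
    unfolding K using assms half by (auto simp: cross2_cyclic[of c b a] cross2_cyclic[of b a c])
qed

text \<open>The coefficient of \<open>bary_grad a b c\<close> when the product rule is applied to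
  \<open>tri_cutoff\<close>. The factor \<open>N\<close> is the inverse width of the layer along the
  edge from \<open>a\<close> to \<open>b\<close>.\<close>

definition cut_layer :: "real \<Rightarrow> real^2 \<Rightarrow> real^2 \<Rightarrow> real^2 \<Rightarrow> real^2 \<Rightarrow> real" where
  "cut_layer N a b c x = N * cutoff_deriv (N * bary a b c x) * cutoff (N * bary b c a x) * cutoff (N * bary c a b x)"

definition tri_cutoff :: "real \<Rightarrow> real^2 \<Rightarrow> real^2 \<Rightarrow> real^2 \<Rightarrow> real^2 \<Rightarrow> real" where
  "tri_cutoff N a b c x = cutoff (N * bary a b c x) * cutoff (N * bary b c a x) * cutoff (N * bary c a b x)"

text \<open>In the coordinates \<open>x = a + s (b - a) + (t / N) (c - a)\<close> the layer concentrates on the edge \<open>t = 0\<close>.\<close>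

lemma cut_layer_limit:
  assumes D: "cross2 (b - a) (c - a) \<noteq> 0"
    and G: "continuous_on UNIV G" "\<And>x. \<bar>G x\<bar> \<le> M"
    and edge: "integral {0..1} (\<lambda>s. G (a + s *\<^sub>R (b - a))) = 0"
  shows "(\<lambda>n. \<integral>x. cut_layer (real (Suc n)) a b c x * G x \<partial>lborel) \<longlonglongrightarrow> 0"
proof -
  \<comment> \<open>The integrand in the scaled coordinates: the factor \<open>N\<close> of the
    layer cancels against the Jacobian, which is the determinant divided by
    \<open>N\<close>.\<close>
  define J where "J n y = cutoff_deriv (snd y) * cutoff (real (Suc n) * (1 - fst y) - snd y) *
      cutoff (real (Suc n) * fst y) * G (a + fst y *\<^sub>R (b - a) + (snd y / real (Suc n)) *\<^sub>R (c - a))"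
    for n :: nat and y :: "real \<times> real"
  \<comment> \<open>The pointwise limit of \<open>J\<close>. The two remaining cut-offs tend to 1
    for 0 < s < 1 and vanish otherwise, also at both end points, because \<open>cutoff\<close> is 0
    up to 1.\<close>
  define L where "L y = cutoff_deriv (snd y) * (indicator {0<..<1} (fst y) * G (a + fst y *\<^sub>R (b - a)))"
    for y :: "real \<times> real"
  define W where "W y = M * cutoff_deriv (snd y) * indicator {0..1} (fst y)" for y :: "real \<times> real"
  have M: "0 \<le> M" using G(2)[of 0] by linarith
  have Gb: "G \<in> borel_measurable borel" using G(1) by (rule borel_measurable_continuous_onI)
  have eq: "(\<integral>x. cut_layer (real (Suc n)) a b c x * G x \<partial>lborel) = \<bar>cross2 (b - a) (c - a)\<bar> * (\<integral>y. J n y \<partial>lborel)" for n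
  proof -
    define N where "N = real (Suc n)"
    have N: "N > 0" by (simp add: N_def)
    have cr: "cross2 (b - a) ((1 / N) *\<^sub>R (c - a)) = cross2 (b - a) (c - a) / N"
      using linear_scale[OF linear_cross2_right] by simp
    have D': "cross2 (b - a) ((1 / N) *\<^sub>R (c - a)) \<noteq> 0" using D N cr by simp
    have "(\<lambda>x. cut_layer N a b c x * G x) \<in> borel_measurable borel"
      unfolding cut_layer_def by (intro borel_measurable_continuous_onI continuous_intros G(1))
    note integral_affine_param[OF D' this, of a]
    moreover have "cut_layer N a b c (a + fst y *\<^sub>R (b - a) + snd y *\<^sub>R (1 / N) *\<^sub>R (c - a)) *
        G (a + fst y *\<^sub>R (b - a) + snd y *\<^sub>R (1 / N) *\<^sub>R (c - a)) = N * J n y" for y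
    proof -
      have x: "snd y *\<^sub>R (1 / N) *\<^sub>R (c - a) = (snd y / N) *\<^sub>R (c - a)" by simp
      have "N * (snd y / N) = snd y" "N * (1 - fst y - snd y / N) = N * (1 - fst y) - snd y"
        using N by (simp_all add: field_simps)
      then show ?thesis
        unfolding x cut_layer_def bary_param[OF D] J_def N_def[symmetric] by simp
    qed
    ultimately show ?thesis unfolding N_def[symmetric] using N by (simp add: cr)
  qed
  have contJ: "continuous_on UNIV (J n)" for n
    unfolding J_def by (intro continuous_intros continuous_on_compose2[OF G(1)]) auto
  have "(\<lambda>n. \<integral>y. J n y \<partial>lborel) \<longlonglongrightarrow> (\<integral>y. L y \<partial>lborel)" and intL: "integrable lborel L"
  proof -
    have Lm: "L \<in> borel_measurable borel"
    proof -
      have "(\<lambda>y::real\<times>real. cutoff_deriv (snd y)) \<in> borel_measurable borel"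
        "(\<lambda>y::real\<times>real. G (a + fst y *\<^sub>R (b - a))) \<in> borel_measurable borel"
        by (intro borel_measurable_continuous_onI continuous_intros continuous_on_compose2[OF G(1)]; simp)+
      moreover have "(\<lambda>y::real\<times>real. indicator {0<..<1} (fst y) :: real) \<in> borel_measurable borel"
        by (simp add: borel_prod[symmetric])
      ultimately show ?thesis unfolding L_def by measurable
    qed
    have Jm: "J n \<in> borel_measurable lborel" for n
      using borel_measurable_continuous_onI[OF contJ] by simp
    have Wi: "integrable lborel W"
    proof -
      have Wm: "W \<in> borel_measurable (lborel \<Otimes>\<^sub>M lborel)"
      proof -
        have "cutoff_deriv \<in> borel_measurable borel"
          using cutoff_continuous(2) by (rule borel_measurable_continuous_onI)
        then show ?thesis unfolding W_def by measurable
      qed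
      have "integrable (lborel \<Otimes>\<^sub>M lborel) W"
      proof (rule lborel_pair.Fubini_integrable[OF Wm])
        have ii: "integrable lborel (\<lambda>y. W (x, y))" for x
          using integrable_cutoff_deriv unfolding W_def by simp
        then show "AE x in lborel. integrable lborel (\<lambda>y. W (x, y))" by simp
        have "(\<integral>y. norm (W (x, y)) \<partial>lborel) = M * (\<integral>y. cutoff_deriv y \<partial>lborel) * indicator {0..1} x" for x :: real
          using M by (simp add: W_def abs_mult cutoff_bounds)
        moreover have "integrable lborel (\<lambda>x::real. M * (\<integral>y. cutoff_deriv y \<partial>lborel) * indicator {0..1} x)"
          by simp
        ultimately show "integrable lborel (\<lambda>x. \<integral>y. norm (W (x, y)) \<partial>lborel)" by simp
      qed
      then show ?thesis by (simp add: lborel_prod)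
    qed
    \<comment> \<open>Where all three factors are nonzero, t > 1 and both cut-off arguments exceed
      1, which forces s into the unit interval; elsewhere \<open>J\<close> is 0.\<close>
    have bound: "norm (J n y) \<le> W y" for n y
    proof (cases "cutoff_deriv (snd y) = 0 \<or> cutoff (real (Suc n) * (1 - fst y) - snd y) = 0 \<or> cutoff (real (Suc n) * fst y) = 0")
      case True
      then show ?thesis using M cutoff_bounds by (auto simp: J_def W_def)
    next
      case False
      then have "snd y > 1" "real (Suc n) * (1 - fst y) - snd y > 1" "real (Suc n) * fst y > 1"
        using cutoff_eq_0 not_le by blast+
      then have "real (Suc n) * (1 - fst y) > 0" "real (Suc n) * fst y > 0" by linarith+
      then have f: "0 \<le> fst y" "fst y \<le> 1" by (simp_all add: zero_less_mult_iff)
      have "norm (J n y) = (cutoff_deriv (snd y) * \<bar>G (a + fst y *\<^sub>R (b - a) + (snd y / real (Suc n)) *\<^sub>R (c - a))\<bar>)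
          * (cutoff (real (Suc n) * (1 - fst y) - snd y) * cutoff (real (Suc n) * fst y))"
        using cutoff_bounds by (simp add: J_def abs_mult mult_ac)
      also have "\<dots> \<le> (cutoff_deriv (snd y) * M) * 1"
        using cutoff_bounds G(2) M by (intro mult_mono mult_le_one mult_nonneg_nonneg) auto
      also have "\<dots> = W y" using f by (simp add: W_def)
      finally show ?thesis .
    qed
    have pw: "(\<lambda>n. J n y) \<longlonglongrightarrow> L y" for y
    proof (cases "0 < fst y \<and> fst y < 1 \<and> cutoff_deriv (snd y) \<noteq> 0")
      case True
      have S: "filterlim (\<lambda>n. real (Suc n)) at_top sequentially"
        using filterlim_compose[OF filterlim_real_sequentially filterlim_Suc] .
      have l1: "(\<lambda>n. cutoff (real (Suc n) * fst y)) \<longlonglongrightarrow> 1"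
        by (rule filterlim_compose[OF cutoff_tendsto_1])
           (rule filterlim_at_top_mult_tendsto_pos[OF tendsto_const _ S], use True in auto)
      have l2: "(\<lambda>n. cutoff (real (Suc n) * (1 - fst y) - snd y)) \<longlonglongrightarrow> 1"
      proof (rule filterlim_compose[OF cutoff_tendsto_1])
        have "filterlim (\<lambda>n. - snd y + real (Suc n) * (1 - fst y)) at_top sequentially"
          by (rule filterlim_tendsto_add_at_top[OF tendsto_const])
             (rule filterlim_at_top_mult_tendsto_pos[OF tendsto_const _ S], use True in auto)
        then show "filterlim (\<lambda>n. real (Suc n) * (1 - fst y) - snd y) at_top sequentially"
          by (simp add: algebra_simps)
      qed
      have "(\<lambda>n. snd y / real (Suc n)) \<longlonglongrightarrow> 0"
        using tendsto_divide_0[OF tendsto_const filterlim_at_top_imp_at_infinity[OF S]] .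
      then have "(\<lambda>n. a + fst y *\<^sub>R (b - a) + (snd y / real (Suc n)) *\<^sub>R (c - a)) \<longlonglongrightarrow>
          a + fst y *\<^sub>R (b - a) + 0 *\<^sub>R (c - a)"
        by (intro tendsto_intros)
      then have l3: "(\<lambda>n. G (a + fst y *\<^sub>R (b - a) + (snd y / real (Suc n)) *\<^sub>R (c - a))) \<longlonglongrightarrow>
          G (a + fst y *\<^sub>R (b - a) + 0 *\<^sub>R (c - a))"
        using G(1) by (intro isCont_tendsto_compose[where g = G]) (auto simp: continuous_on_eq_continuous_at)
      have "(\<lambda>n. J n y) \<longlonglongrightarrow> cutoff_deriv (snd y) * 1 * 1 * G (a + fst y *\<^sub>R (b - a) + 0 *\<^sub>R (c - a))"
        unfolding J_def by (intro tendsto_mult tendsto_const l1 l2 l3)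
      then show ?thesis using True by (simp add: L_def)
    next
      case False
      have "J n y = 0" for n
      proof (cases "cutoff_deriv (snd y) = 0")
        case True
        then show ?thesis by (simp add: J_def)
      next
        case nz: False
        then have t: "snd y > 1" using cutoff_eq_0(2) not_le by blast
        have "fst y \<le> 0 \<or> fst y \<ge> 1" using False nz by auto
        then have "real (Suc n) * fst y \<le> 0 \<or> real (Suc n) * (1 - fst y) \<le> 0"
          by (metis diff_le_0_iff_le mult_nonneg_nonpos of_nat_0_le_iff)
        then have "real (Suc n) * fst y \<le> 1 \<or> real (Suc n) * (1 - fst y) - snd y \<le> 1" using t by linarith
        then show ?thesis using cutoff_eq_0(1) by (auto simp: J_def)
      qed
      moreover have "L y = 0" using False by (auto simp: L_def indicator_def)
      ultimately show ?thesis by simp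
    qed
    show "(\<lambda>n. \<integral>y. J n y \<partial>lborel) \<longlonglongrightarrow> (\<integral>y. L y \<partial>lborel)"
      by (rule integral_dominated_convergence[where s = J, OF _ Jm Wi]) (use Lm pw bound in auto)
    show "integrable lborel L"
      by (rule integrable_dominated_convergence[where s = J, OF _ Jm Wi]) (use Lm pw bound in auto)
  qed
  \<comment> \<open>Fubini along the edge first: for each t the inner integral is a multiple of the
    edge integral, which is 0 by hypothesis.\<close>
  moreover have "(\<integral>y. L y \<partial>lborel) = 0"
  proof -
    have i: "integrable (lborel \<Otimes>\<^sub>M lborel) (case_prod (\<lambda>s t. L (s, t)))"
      using intL by (simp add: lborel_prod)
    have e: "(\<integral>s. indicator {0<..<1} s * G (a + s *\<^sub>R (b - a)) \<partial>lborel) = 0"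
    proof -
      have c: "continuous_on UNIV (\<lambda>s. G (a + s *\<^sub>R (b - a)))"
        by (intro continuous_on_compose2[OF G(1)] continuous_intros) auto
      have "set_integrable lborel {0..1} (\<lambda>s. G (a + s *\<^sub>R (b - a)))"
        by (rule borel_integrable_atLeastAtMost') (rule continuous_on_subset[OF c], simp)
      from set_borel_integral_eq_integral(2)[OF this]
      have "(\<integral>s. indicator {0..1} s * G (a + s *\<^sub>R (b - a)) \<partial>lborel) = 0"
        by (simp add: set_lebesgue_integral_def edge)
      moreover have "(\<integral>s. indicator {0<..<1} s * G (a + s *\<^sub>R (b - a)) \<partial>lborel) =
          (\<integral>s. indicator {0..1} s * G (a + s *\<^sub>R (b - a)) \<partial>lborel)"
      proof (rule integral_cong_AE)
        show "AE s in lborel. indicator {0<..<1} s * G (a + s *\<^sub>R (b - a)) = indicator {0..1} s * G (a + s *\<^sub>R (b - a))"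
          using AE_lborel_singleton[of "0::real"] AE_lborel_singleton[of "1::real"]
          by eventually_elim (auto simp: indicator_def)
      qed (use borel_measurable_continuous_onI[OF c] in measurable)
      ultimately show ?thesis by simp
    qed
    have "(\<integral>y. L y \<partial>lborel) = (\<integral>y. case_prod (\<lambda>s t. L (s, t)) y \<partial>(lborel \<Otimes>\<^sub>M lborel))"
      by (simp add: lborel_prod)
    also have "\<dots> = (\<integral>t. (\<integral>s. L (s, t) \<partial>lborel) \<partial>lborel)"
      using lborel_pair.integral_snd[OF i] by simp
    also have "\<dots> = 0" by (simp add: L_def e)
    finally show ?thesis .
  qed
  ultimately show ?thesis unfolding eq using tendsto_mult[OF tendsto_const, of _ 0] by fastforce
qed

section \<open>The integral of the Laplacian over a triangle\<close>

lemma grad_eqI: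
  assumes "(f has_derivative (\<lambda>h. v \<bullet> h)) (at x)"
  shows "grad f x = v"
  by (simp add: grad_def pd_eqI[OF assms] vec_eq_iff inner_axis)

lemma cutoff_bary_bump: "(\<lambda>x. cutoff (N * bary a b c x)) \<in> bump_algebra"
proof -
  have "cutoff (N * bary a b c x) = bump 1 ((N *\<^sub>R bary_grad a b c) \<bullet> x + (N * bary a b c 0 - 1))" for x
    unfolding cutoff_def by (subst bary_affine) (simp add: algebra_simps)
  then show ?thesis by (simp only: bump_algebra.bump)
qed

lemma cutoff_bary_derivative:
  "((\<lambda>x. cutoff (N * bary a b c x)) has_derivative
     (\<lambda>h. N * cutoff_deriv (N * bary a b c x) * (bary_grad a b c \<bullet> h))) (at x)"
proof -
  have "((\<lambda>x. N * (bary_grad a b c \<bullet> x + bary a b c 0)) has_derivative (\<lambda>h. N * (bary_grad a b c \<bullet> h))) (at x)"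
    by (auto intro!: derivative_eq_intros)
  then have "((\<lambda>x. N * bary a b c x) has_derivative (\<lambda>h. N * (bary_grad a b c \<bullet> h))) (at x)"
    by (simp flip: bary_affine)
  from has_derivative_compose[OF this cutoff_has_derivative[unfolded has_field_derivative_def]]
  show ?thesis by (simp add: mult_ac)
qed

lemma grad_tri_cutoff:
  "grad (tri_cutoff N a b c) x = cut_layer N a b c x *\<^sub>R bary_grad a b c +
     cut_layer N b c a x *\<^sub>R bary_grad b c a + cut_layer N c a b x *\<^sub>R bary_grad c a b"
proof (rule grad_eqI)
  show "(tri_cutoff N a b c has_derivative (\<lambda>h. (cut_layer N a b c x *\<^sub>R bary_grad a b c +
     cut_layer N b c a x *\<^sub>R bary_grad b c a + cut_layer N c a b x *\<^sub>R bary_grad c a b) \<bullet> h)) (at x)"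
    using has_derivative_mult[OF has_derivative_mult[OF cutoff_bary_derivative[of N a b c x]
          cutoff_bary_derivative[of N b c a x]] cutoff_bary_derivative[of N c a b x]]
    by (simp add: tri_cutoff_def[abs_def] cut_layer_def algebra_simps)
qed

lemma tri_cutoff_bounds: "\<bar>tri_cutoff N a b c x\<bar> \<le> 1"
  unfolding tri_cutoff_def using cutoff_bounds
  by (simp add: abs_mult mult_le_one)

lemma tri_cutoff_tendsto_1:
  assumes "bary a b c x > 0" "bary b c a x > 0" "bary c a b x > 0"
  shows "(\<lambda>n. tri_cutoff (real (Suc n)) a b c x) \<longlonglongrightarrow> 1"
proof -
  have S: "filterlim (\<lambda>n. real (Suc n)) at_top sequentially"
    using filterlim_compose[OF filterlim_real_sequentially filterlim_Suc] .
  have "(\<lambda>n. cutoff (real (Suc n) * y)) \<longlonglongrightarrow> 1" if "y > 0" for y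
    by (rule filterlim_compose[OF cutoff_tendsto_1])
       (rule filterlim_at_top_mult_tendsto_pos[OF tendsto_const that S])
  from tendsto_mult[OF tendsto_mult[OF this[OF assms(1)] this[OF assms(2)]] this[OF assms(3)]]
  show ?thesis by (simp add: tri_cutoff_def)
qed

context
  fixes a b c :: "real^2"
  assumes D: "cross2 (b - a) (c - a) \<noteq> 0"
begin

text \<open>A compact subset of the open triangle outside which \<open>tri_cutoff N\<close> and all
  three layers vanish; the bound 1 is the threshold of \<open>cutoff\<close>.\<close>

definition inner_triangle :: "real \<Rightarrow> (real^2) set" where
  "inner_triangle N = {x. 1 \<le> N * bary a b c x \<and> 1 \<le> N * bary b c a x \<and> 1 \<le> N * bary c a b x}"

lemma inner_triangle:
  assumes "N > 0"
  shows "compact (inner_triangle N)" "inner_triangle N \<subseteq> interior (convex hull {a, b, c})"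
    "x \<notin> inner_triangle N \<Longrightarrow> tri_cutoff N a b c x = 0"
    "x \<notin> inner_triangle N \<Longrightarrow> cut_layer N a b c x = 0"
    "x \<notin> inner_triangle N \<Longrightarrow> cut_layer N b c a x = 0"
    "x \<notin> inner_triangle N \<Longrightarrow> cut_layer N c a b x = 0"
proof -
  have "0 < y" if "1 \<le> N * y" for y
    using that assms by (metis less_le_trans zero_less_mult_pos zero_less_one)
  then show sub: "inner_triangle N \<subseteq> interior (convex hull {a, b, c})"
    unfolding triangle_bary(2)[OF D] inner_triangle_def by auto
  have "closed (inner_triangle N)"
    unfolding inner_triangle_def by (intro closed_Collect_conj closed_Collect_le continuous_intros)
  moreover have "bounded (inner_triangle N)"
    using sub interior_subset by (rule bounded_subset[OF finite_imp_bounded_convex_hull, rotated, OF subset_trans]) simp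
  ultimately show "compact (inner_triangle N)" by (simp add: compact_eq_bounded_closed)
  show "x \<notin> inner_triangle N \<Longrightarrow> tri_cutoff N a b c x = 0"
    "x \<notin> inner_triangle N \<Longrightarrow> cut_layer N a b c x = 0"
    "x \<notin> inner_triangle N \<Longrightarrow> cut_layer N b c a x = 0"
    "x \<notin> inner_triangle N \<Longrightarrow> cut_layer N c a b x = 0"
    by (auto simp: inner_triangle_def tri_cutoff_def cut_layer_def cutoff_eq_0)
qed

lemma tri_cutoff_test_function:
  assumes "N > 0"
  shows "tri_cutoff N a b c \<in> test_functions (interior (convex hull {a, b, c}))"
proof (rule bump_algebra_test_function[OF _ inner_triangle(1,2,3)[OF assms]])
  show "tri_cutoff N a b c \<in> bump_algebra"
    unfolding tri_cutoff_def by (intro bump_algebra.mult cutoff_bary_bump)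
qed

text \<open>Gauss' theorem in the case of vanishing fluxes. As \<open>bary_grad\<close> is normal to
  its edge, the three edge hypotheses say that the mean flux of \<open>g\<close> through each edge
  is 0, and each makes the limit of one layer vanish.\<close>

theorem integral_wlaplacian_triangle:
  assumes w: "\<And>x. x \<in> interior (convex hull {a, b, c}) \<Longrightarrow> w differentiable (at x)"
    and g: "continuous_on (convex hull {a, b, c}) g" "\<And>x. x \<in> interior (convex hull {a, b, c}) \<Longrightarrow> g x = grad w x"
    and edges: "integral {0..1} (\<lambda>s. bary_grad a b c \<bullet> g (a + s *\<^sub>R (b - a))) = 0"
      "integral {0..1} (\<lambda>s. bary_grad b c a \<bullet> g (b + s *\<^sub>R (c - b))) = 0"
      "integral {0..1} (\<lambda>s. bary_grad c a b \<bullet> g (c + s *\<^sub>R (a - c))) = 0"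
    and ex: "\<And>i. \<exists>h. is_weak_deriv (interior (convex hull {a, b, c})) [i, i] w h"
  shows "(LINT x|lebesgue_on (interior (convex hull {a, b, c})). wlaplacian (interior (convex hull {a, b, c})) w x) = 0"
proof -
  define K where "K = convex hull {a, b, c}"
  define U where "U = interior K"
  have U: "open U" by (simp add: U_def)
  have K: "convex K" "compact K" "closed K" "K \<noteq> {}"
    by (auto simp: K_def compact_imp_closed finite_imp_compact_convex_hull)
  have UK: "U \<subseteq> K" by (simp add: U_def interior_subset)
  text \<open>The projection onto the triangle extends \<open>g\<close> to a bounded continuous field on the plane.\<close>
  define G where "G x = g (closest_point K x)" for x
  have G: "continuous_on UNIV G"
    unfolding G_def
    by (rule continuous_on_compose2[OF g(1)[folded K_def] continuous_on_closest_point[OF K(1,3,4)]])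
       (use closest_point_in_set[OF K(3,4)] in auto)
  have GK: "G x = g x" if "x \<in> K" for x by (simp add: G_def closest_point_self[OF that])
  obtain M where M: "\<And>x. norm (G x) \<le> M"
  proof -
    have "compact (g ` K)" using compact_continuous_image[OF g(1)[folded K_def] K(2)] .
    then obtain M where "\<And>x. x \<in> K \<Longrightarrow> norm (g x) \<le> M"
      using compact_imp_bounded bounded_iff by (metis imageI)
    then show ?thesis using that closest_point_in_set[OF K(3,4)] by (auto simp: G_def)
  qed
  have seg: "p + s *\<^sub>R (q - p) \<in> K" if "s \<in> {0..1}" "p \<in> K" "q \<in> K" for p q s
    using convexD_alt[OF K(1) that(2,3), of s] that(1) by (simp add: algebra_simps)
  have abc: "a \<in> K" "b \<in> K" "c \<in> K" by (auto simp: K_def hull_inc)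
  have limit: "(\<lambda>n. \<integral>x. cut_layer (real (Suc n)) p q r x * (bary_grad p q r \<bullet> G x) \<partial>lborel) \<longlonglongrightarrow> 0"
    if "cross2 (q - p) (r - p) \<noteq> 0" "p \<in> K" "q \<in> K"
      "integral {0..1} (\<lambda>s. bary_grad p q r \<bullet> g (p + s *\<^sub>R (q - p))) = 0" for p q r
  proof (rule cut_layer_limit[OF that(1), where M = "norm (bary_grad p q r) * M"])
    show "continuous_on UNIV (\<lambda>x. bary_grad p q r \<bullet> G x)" by (intro continuous_intros G)
    show "\<bar>bary_grad p q r \<bullet> G x\<bar> \<le> norm (bary_grad p q r) * M" for x
      using Cauchy_Schwarz_ineq2[of "bary_grad p q r" "G x"] mult_left_mono[OF M[of x] norm_ge_zero[of "bary_grad p q r"]]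
      by linarith
    have "integral {0..1} (\<lambda>s. bary_grad p q r \<bullet> G (p + s *\<^sub>R (q - p))) =
        integral {0..1} (\<lambda>s. bary_grad p q r \<bullet> g (p + s *\<^sub>R (q - p)))"
      by (rule integral_cong) (use GK seg that(2,3) in auto)
    then show "integral {0..1} (\<lambda>s. bary_grad p q r \<bullet> G (p + s *\<^sub>R (q - p))) = 0" using that(4) by simp
  qed
  have D2: "cross2 (c - b) (a - b) \<noteq> 0" "cross2 (a - c) (b - c) \<noteq> 0"
    using D by (simp_all add: cross2_cyclic[of c b a] cross2_cyclic[of b a c])
  define \<phi> where "\<phi> n = tri_cutoff (real (Suc n)) a b c" for n
  have split: "(LINT x|lebesgue_on U. grad w x \<bullet> grad (\<phi> n) x) =
      (\<integral>x. cut_layer (real (Suc n)) a b c x * (bary_grad a b c \<bullet> G x) \<partial>lborel) +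
      (\<integral>x. cut_layer (real (Suc n)) b c a x * (bary_grad b c a \<bullet> G x) \<partial>lborel) +
      (\<integral>x. cut_layer (real (Suc n)) c a b x * (bary_grad c a b \<bullet> G x) \<partial>lborel)" for n
  proof -
    define N where "N = real (Suc n)"
    define h where "h p q r x = cut_layer N p q r x * (bary_grad p q r \<bullet> G x)" for p q r x
    have N: "N > 0" by (simp add: N_def)
    note inner = inner_triangle[OF N, folded K_def, folded U_def]
    have hc: "continuous_on S (h p q r)" for p q r S
      unfolding h_def cut_layer_def by (intro continuous_intros continuous_on_subset[OF G]) auto
    have h0: "h a b c x = 0" "h b c a x = 0" "h c a b x = 0" if "x \<notin> inner_triangle N" for x
      using inner(4-6)[OF that] by (simp_all add: h_def)
    have ext: "(\<lambda>x. if x \<in> U then h p q r x else 0) = h p q r"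
      if "\<And>x. x \<notin> inner_triangle N \<Longrightarrow> h p q r x = 0" for p q r
      using inner(2) that by (intro ext) auto
    have int: "integrable lborel (h p q r)" "integrable (lebesgue_on U) (h p q r)"
      "(LINT x|lebesgue_on U. h p q r x) = (\<integral>x. h p q r x \<partial>lborel)"
      if z: "\<And>x. x \<notin> inner_triangle N \<Longrightarrow> h p q r x = 0" for p q r
      using compactly_supported_integral[OF U hc inner(1,2) z] ext[OF z] by simp_all
    \<comment> \<open>\<open>grad w\<close> equals \<open>G\<close> only inside the triangle, but
      the layers vanish off \<open>inner_triangle N\<close>, so each term becomes an integral over
      the plane, as the limit of layers requires.\<close>
    have "(LINT x|lebesgue_on U. grad w x \<bullet> grad (\<phi> n) x) = (LINT x|lebesgue_on U. h a b c x + h b c a x + h c a b x)"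
    proof (rule Bochner_Integration.integral_cong[OF refl])
      fix x assume "x \<in> space (lebesgue_on U)"
      then have x: "x \<in> U" by (simp add: space_restrict_space)
      then have "grad w x = G x" using g(2)[folded K_def, folded U_def] GK UK by auto
      then show "grad w x \<bullet> grad (\<phi> n) x = h a b c x + h b c a x + h c a b x"
        unfolding \<phi>_def grad_tri_cutoff h_def N_def
        by (simp add: inner_add_right inner_commute)
    qed
    also have "\<dots> = (\<integral>x. h a b c x \<partial>lborel) + (\<integral>x. h b c a x \<partial>lborel) + (\<integral>x. h c a b x \<partial>lborel)"
      using int[OF h0(1)] int[OF h0(2)] int[OF h0(3)] by simp
    finally show ?thesis by (simp add: h_def N_def)
  qed
  have "(LINT x|lebesgue_on U. wlaplacian U w x) = 0"
  proof (rule integral_wlaplacian_eq_0[OF U, where \<phi> = \<phi>])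
    show "w differentiable (at x)" if "x \<in> U" for x using w that by (simp add: U_def K_def)
    show "continuous_on U (pd i w)" for i
    proof -
      have "continuous_on U (\<lambda>x. g x $ i)"
        using g(1) UK by (intro continuous_intros) (auto simp: K_def intro: continuous_on_subset)
      then show ?thesis
        by (rule continuous_on_eq) (use g(2) in \<open>auto simp: U_def K_def grad_def\<close>)
    qed
    show "\<exists>h. is_weak_deriv U [i, i] w h" for i using ex by (simp add: U_def K_def)
    show "\<phi> n \<in> test_functions U" for n
      unfolding \<phi>_def U_def K_def by (rule tri_cutoff_test_function) simp
    show "\<bar>\<phi> n x\<bar> \<le> 1" for n x unfolding \<phi>_def by (rule tri_cutoff_bounds)
    show "(\<lambda>n. \<phi> n x) \<longlonglongrightarrow> 1" if "x \<in> U" for x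
      unfolding \<phi>_def using that triangle_bary(2)[OF D]
      by (intro tri_cutoff_tendsto_1) (auto simp: U_def K_def)
    show "(\<lambda>n. LINT x|lebesgue_on U. grad w x \<bullet> grad (\<phi> n) x) \<longlonglongrightarrow> 0"
      unfolding split
      using tendsto_add[OF tendsto_add[OF limit[OF D abc(1,2) edges(1)] limit[OF D2(1) abc(2,3) edges(2)]]
          limit[OF D2(2) abc(3,1) edges(3)]] by simp
  qed
  then show ?thesis by (simp add: U_def K_def)
qed

end

section \<open>Traces of gradients from inside a triangle\<close>

text \<open>\<open>Lim\<close> is meaningful only along a nontrivial filter: a convex set with
  nonempty interior lies in the closure of its interior, so every point of \<open>K\<close> is a
  limit point of it.\<close>

lemma tr_eqI:
  fixes f g :: "real^2 \<Rightarrow> 'a::t2_space"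
  assumes K: "convex K" "interior K \<noteq> {}" and x: "x \<in> K"
    and g: "continuous_on K g" "\<And>y. y \<in> interior K \<Longrightarrow> f y = g y"
  shows "tr K f x = g x"
proof -
  have "x islimpt interior K"
  proof (cases "x \<in> interior K")
    case True
    then show ?thesis using interior_limit_point interior_interior by metis
  next
    case False
    have "x \<in> closure (interior K)" using convex_closure_interior[OF K] x closure_subset by blast
    then show ?thesis using False by (simp add: closure_def)
  qed
  then have nt: "at x within interior K \<noteq> bot" by (simp add: trivial_limit_within)
  have "(g \<longlongrightarrow> g x) (at x within K)" using g(1) x by (simp add: continuous_on_def)
  then have "(g \<longlongrightarrow> g x) (at x within interior K)"
    by (rule tendsto_within_subset) (rule interior_subset)
  then have "(f \<longlongrightarrow> g x) (at x within interior K)"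
    by (rule Lim_transform_eventually) (auto simp: eventually_at_filter g(2))
  then show ?thesis unfolding tr_def using nt by (intro tendsto_Lim) auto
qed

text \<open>The gradient part of \<open>C1_on_triangle\<close>, which quadratics and HCT functions
  share and which is stable under linear combinations.\<close>

definition C1_closure :: "(real^2) set \<Rightarrow> (real^2 \<Rightarrow> real) \<Rightarrow> bool" where
  "C1_closure K v \<longleftrightarrow> (\<forall>x\<in>interior K. v differentiable (at x)) \<and>
     (\<exists>g. continuous_on K g \<and> (\<forall>x\<in>interior K. g x = grad v x))"

lemma grad_lincomb:
  assumes "v differentiable (at x)" "w differentiable (at x)"
  shows "grad (\<lambda>x. \<alpha> * v x + \<beta> * w x) x = \<alpha> *\<^sub>R grad v x + \<beta> *\<^sub>R grad w x"
proof (rule grad_eqI)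
  show "((\<lambda>x. \<alpha> * v x + \<beta> * w x) has_derivative (\<lambda>h. (\<alpha> *\<^sub>R grad v x + \<beta> *\<^sub>R grad w x) \<bullet> h)) (at x)"
    using has_derivative_add[OF has_derivative_mult_right[OF has_derivative_grad[OF assms(1)], of \<alpha>]
        has_derivative_mult_right[OF has_derivative_grad[OF assms(2)], of \<beta>]]
    by (simp add: inner_add_left)
qed

lemma grad_zero: "grad (\<lambda>x. 0) x = 0"
  by (rule grad_eqI) simp

context
  fixes K :: "(real^2) set"
  assumes K: "convex K" "interior K \<noteq> {}"
begin

lemma C1_closure_tr:
  assumes "C1_closure K v"
  shows "continuous_on K (tr K (grad v))" "x \<in> interior K \<Longrightarrow> tr K (grad v) x = grad v x"
proof -
  obtain g where g: "continuous_on K g" "\<And>x. x \<in> interior K \<Longrightarrow> g x = grad v x"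
    using assms unfolding C1_closure_def by auto
  have "tr K (grad v) x = g x" if "x \<in> K" for x
    using tr_eqI[OF K that g(1)] g(2) by simp
  then show "continuous_on K (tr K (grad v))" "x \<in> interior K \<Longrightarrow> tr K (grad v) x = grad v x"
    using g interior_subset[of K] by (auto intro: continuous_on_eq)
qed

lemma C1_closure_lincomb:
  assumes "C1_closure K v" "C1_closure K w"
  shows "C1_closure K (\<lambda>x. \<alpha> * v x + \<beta> * w x)"
    and "x \<in> K \<Longrightarrow> tr K (grad (\<lambda>x. \<alpha> * v x + \<beta> * w x)) x = \<alpha> *\<^sub>R tr K (grad v) x + \<beta> *\<^sub>R tr K (grad w) x"
proof -
  let ?g = "\<lambda>x. \<alpha> *\<^sub>R tr K (grad v) x + \<beta> *\<^sub>R tr K (grad w) x"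
  have d: "v differentiable (at x)" "w differentiable (at x)" if "x \<in> interior K" for x
    using assms that by (auto simp: C1_closure_def)
  have c: "continuous_on K ?g" by (intro continuous_intros C1_closure_tr assms)
  have e: "grad (\<lambda>x. \<alpha> * v x + \<beta> * w x) y = ?g y" if "y \<in> interior K" for y
    using grad_lincomb[OF d[OF that]] C1_closure_tr(2)[OF _ that] assms by simp
  show "C1_closure K (\<lambda>x. \<alpha> * v x + \<beta> * w x)"
    unfolding C1_closure_def
    using d c e by (auto intro!: differentiable_add differentiable_mult exI[of _ ?g])
  show "tr K (grad (\<lambda>x. \<alpha> * v x + \<beta> * w x)) x = ?g x" if "x \<in> K"
    using tr_eqI[OF K that c] e by simp
qed

text \<open>Both claims are proved in one induction, since the trace formula for the enlarged sum
  uses that the smaller sum is of class \<open>C1_closure\<close>.\<close>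

lemma C1_closure_sum:
  assumes "finite E" "\<And>e. e \<in> E \<Longrightarrow> C1_closure K (f e)"
  shows "C1_closure K (\<lambda>x. \<Sum>e\<in>E. k e * f e x) \<and>
    (\<forall>x\<in>K. tr K (grad (\<lambda>x. \<Sum>e\<in>E. k e * f e x)) x = (\<Sum>e\<in>E. k e *\<^sub>R tr K (grad (f e)) x))"
  using assms
proof (induction rule: finite_induct)
  case empty
  have "C1_closure K (\<lambda>x. 0)"
    unfolding C1_closure_def by (auto intro!: exI[of _ "\<lambda>_. 0"] simp: grad_zero)
  moreover have "tr K (grad (\<lambda>x. 0)) x = 0" if "x \<in> K" for x
    by (rule tr_eqI[OF K that continuous_on_const]) (simp add: grad_zero)
  ultimately show ?case by simp
next
  case (insert e E)
  have "C1_closure K (f e)" "C1_closure K (\<lambda>x. \<Sum>e\<in>E. k e * f e x)" using insert by auto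
  from C1_closure_lincomb[OF this, where \<alpha> = "k e" and \<beta> = 1] show ?case
    using insert by simp
qed

end

section \<open>Polynomials and triangles\<close>

lemma poly2_lincomb:
  assumes "p \<in> poly2 k" "q \<in> poly2 k"
  shows "(\<lambda>x. \<alpha> * p x + \<beta> * q x) \<in> poly2 k"
proof -
  obtain c d where "\<And>x. p x = (\<Sum>i\<le>k. \<Sum>j\<le>k - i. c i j * (x $ 1) ^ i * (x $ 2) ^ j)"
    "\<And>x. q x = (\<Sum>i\<le>k. \<Sum>j\<le>k - i. d i j * (x $ 1) ^ i * (x $ 2) ^ j)"
    using assms unfolding poly2_def by auto
  then have "\<alpha> * p x + \<beta> * q x = (\<Sum>i\<le>k. \<Sum>j\<le>k - i. (\<alpha> * c i j + \<beta> * d i j) * (x $ 1) ^ i * (x $ 2) ^ j)" for x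
    by (simp add: sum_distrib_left sum.distrib algebra_simps)
  then show ?thesis
    unfolding poly2_def by (intro CollectI exI[of _ "\<lambda>i j. \<alpha> * c i j + \<beta> * d i j"]) auto
qed

text \<open>For exponent 0 the truncated \<open>i - 1\<close> is harmless, as the factor
  \<open>real i\<close> is 0.\<close>

lemma has_derivative_monomial2:
  "((\<lambda>x::real^2. k * (x $ 1) ^ i * (x $ 2) ^ j) has_derivative
    (\<lambda>h. k * (real i * (x $ 1) ^ (i - 1)) * (x $ 2) ^ j * h $ 1 + k * (x $ 1) ^ i * (real j * (x $ 2) ^ (j - 1)) * h $ 2)) (at x)"
proof -
  have 1: "((\<lambda>x::real^2. x $ m) has_derivative (\<lambda>h. h $ m)) (at x)" for m
    by (rule bounded_linear.has_derivative[OF bounded_linear_vec_nth has_derivative_ident])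
  show ?thesis
    using has_derivative_mult[OF has_derivative_mult_right[OF has_derivative_power[OF 1[of 1], of i], of k]
        has_derivative_power[OF 1[of 2], of j]]
    by (simp add: mult_ac add.commute)
qed

lemma poly2_differentiable: "p \<in> poly2 k \<Longrightarrow> p differentiable (at x)"
proof -
  assume "p \<in> poly2 k"
  then obtain c where p: "p = (\<lambda>x. \<Sum>i\<le>k. \<Sum>j\<le>k - i. c i j * (x $ 1) ^ i * (x $ 2) ^ j)"
    unfolding poly2_def by auto
  have "(p has_derivative (\<lambda>h. \<Sum>i\<le>k. \<Sum>j\<le>k - i.
      (c i j * (real i * (x $ 1) ^ (i - 1)) * (x $ 2) ^ j * h $ 1 +
       c i j * (x $ 1) ^ i * (real j * (x $ 2) ^ (j - 1)) * h $ 2))) (at x)"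
    unfolding p by (intro has_derivative_sum has_derivative_monomial2)
  then show ?thesis unfolding differentiable_def by blast
qed

lemma poly2_continuous: "p \<in> poly2 k \<Longrightarrow> continuous_on S p"
  by (simp add: poly2_differentiable differentiable_imp_continuous_within continuous_at_imp_continuous_on)

lemma pd_poly2:
  assumes "p \<in> poly2 (Suc m)"
  shows "pd l p \<in> poly2 m"
proof -
  obtain c where c: "p = (\<lambda>x. \<Sum>i\<le>Suc m. \<Sum>j\<le>Suc m - i. c i j * (x $ 1) ^ i * (x $ 2) ^ j)"
    using assms unfolding poly2_def by auto
  have D: "(p has_derivative (\<lambda>h. \<Sum>i\<le>Suc m. \<Sum>j\<le>Suc m - i.
      (c i j * (real i * (x $ 1) ^ (i - 1)) * (x $ 2) ^ j * h $ 1 +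
       c i j * (x $ 1) ^ i * (real j * (x $ 2) ^ (j - 1)) * h $ 2))) (at x)" for x
    unfolding c by (intro has_derivative_sum has_derivative_monomial2)
  have p1: "pd 1 p x = (\<Sum>i\<le>m. \<Sum>j\<le>m - i. (real (Suc i) * c (Suc i) j) * (x $ 1) ^ i * (x $ 2) ^ j)" for x
  proof -
    have "pd 1 p x = (\<Sum>i\<le>Suc m. \<Sum>j\<le>Suc m - i. c i j * (real i * (x $ 1) ^ (i - 1)) * (x $ 2) ^ j)"
      by (subst pd_eqI[OF D]) (simp add: axis_def)
    \<comment> \<open>The row of exponent 0 disappears, and shifting \<open>i\<close> turns the
      range of \<open>j\<close> into \<open>m - i\<close>.\<close>
    also have "\<dots> = (\<Sum>i\<le>m. \<Sum>j\<le>m - i. c (Suc i) j * (real (Suc i) * (x $ 1) ^ i) * (x $ 2) ^ j)"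
      by (subst sum.atMost_Suc_shift) simp
    finally show ?thesis by (simp add: mult_ac)
  qed
  have p2: "pd 2 p x = (\<Sum>i\<le>m. \<Sum>j\<le>m - i. (real (Suc j) * c i (Suc j)) * (x $ 1) ^ i * (x $ 2) ^ j)" for x
  proof -
    have "pd 2 p x = (\<Sum>i\<le>Suc m. \<Sum>j\<le>Suc m - i. c i j * (x $ 1) ^ i * (real j * (x $ 2) ^ (j - 1)))"
      by (subst pd_eqI[OF D]) (simp add: axis_def)
    \<comment> \<open>The row \<open>i = Suc m\<close> consists of \<open>j = 0\<close> only, where
      the factor \<open>real j\<close> is 0.\<close>
    also have "\<dots> = (\<Sum>i\<le>m. \<Sum>j\<le>Suc m - i. c i j * (x $ 1) ^ i * (real j * (x $ 2) ^ (j - 1)))"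
      by simp
    also have "\<dots> = (\<Sum>i\<le>m. \<Sum>j\<le>m - i. c i (Suc j) * (x $ 1) ^ i * (real (Suc j) * (x $ 2) ^ j))"
    proof (rule sum.cong[OF refl])
      fix i assume "i \<in> {..m}"
      then have "Suc m - i = Suc (m - i)" by auto
      then show "(\<Sum>j\<le>Suc m - i. c i j * (x $ 1) ^ i * (real j * (x $ 2) ^ (j - 1))) =
          (\<Sum>j\<le>m - i. c i (Suc j) * (x $ 1) ^ i * (real (Suc j) * (x $ 2) ^ j))"
        by (simp only:) (subst sum.atMost_Suc_shift, simp)
    qed
    finally show ?thesis by (simp add: mult_ac)
  qed
  consider "l = 1" | "l = 2" using exhaust_2[of l] by auto
  then show ?thesis
  proof cases
    case 1
    then show ?thesis using p1
      unfolding poly2_def by (intro CollectI exI[of _ "\<lambda>i j. real (Suc i) * c (Suc i) j"]) auto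
  next
    case 2
    then show ?thesis using p2
      unfolding poly2_def by (intro CollectI exI[of _ "\<lambda>i j. real (Suc j) * c i (Suc j)"]) auto
  qed
qed

lemma normal_grad_poly2:
  assumes "p \<in> poly2 (Suc m)"
  shows "(\<lambda>x. n \<bullet> grad p x) \<in> poly2 m"
  using poly2_lincomb[OF pd_poly2[OF assms, of 1] pd_poly2[OF assms, of 2], of "n $ 1" "n $ 2"]
  by (simp add: inner_vec_def sum_2 grad_def)

lemma continuous_grad_poly2: "p \<in> poly2 (Suc m) \<Longrightarrow> continuous_on S (grad p)"
  unfolding grad_def by (intro continuous_on_vec_lambda poly2_continuous[OF pd_poly2])

section \<open>Exact quadrature on a segment\<close>

lemma integral_quadratic: "integral {0..1} (\<lambda>t::real. A + B * t + C * t\<^sup>2) = A + B / 2 + C / 3"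
proof -
  have "((\<lambda>t. A * t + B * t\<^sup>2 / 2 + C * t ^ 3 / 3) has_vector_derivative (A + B * t + C * t\<^sup>2)) (at t within {0..1})" for t
    unfolding has_real_derivative_iff_has_vector_derivative[symmetric]
    by (auto intro!: derivative_eq_intros)
  then have "((\<lambda>t. A + B * t + C * t\<^sup>2) has_integral
      (A * 1 + B * 1\<^sup>2 / 2 + C * 1 ^ 3 / 3 - (A * 0 + B * 0\<^sup>2 / 2 + C * 0 ^ 3 / 3))) {0..1}"
    by (intro fundamental_theorem_of_calculus) auto
  then show ?thesis by (intro integral_unique) simp
qed

lemma simpson_rule:
  assumes "p \<in> poly2 2"
  shows "integral {0..1} (\<lambda>t. p ((1 - t) *\<^sub>R a + t *\<^sub>R b)) = (p a + 4 * p (midpoint a b) + p b) / 6"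
proof -
  obtain c where c: "\<And>x. p x = (\<Sum>i\<le>2. \<Sum>j\<le>2 - i. c i j * (x $ 1) ^ i * (x $ 2) ^ j)"
    using assms unfolding poly2_def by auto
  have c': "p x = c 0 0 + c 0 1 * x $ 2 + c 0 2 * (x $ 2)\<^sup>2 + c 1 0 * x $ 1 + c 1 1 * x $ 1 * x $ 2 + c 2 0 * (x $ 1)\<^sup>2" for x
    unfolding c by (simp add: numeral_2_eq_2)
  define d where "d = b - a"
  \<comment> \<open>\<open>B\<close> and \<open>C\<close> are the coefficients of t and t^2 in the
    restriction of \<open>p\<close> to the line \<open>a + t *\<^sub>R d\<close>.\<close>
  define B where "B = c 0 1 * d $ 2 + c 0 2 * (2 * a $ 2 * d $ 2) + c 1 0 * d $ 1 + c 1 1 * (a $ 1 * d $ 2 + a $ 2 * d $ 1) + c 2 0 * (2 * a $ 1 * d $ 1)"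
  define C where "C = c 0 2 * (d $ 2)\<^sup>2 + c 1 1 * d $ 1 * d $ 2 + c 2 0 * (d $ 1)\<^sup>2"
  have q: "p (a + t *\<^sub>R d) = p a + B * t + C * t\<^sup>2" for t
    unfolding c' B_def C_def by (simp add: power2_eq_square algebra_simps)
  have "(1 - t) *\<^sub>R a + t *\<^sub>R b = a + t *\<^sub>R d" for t by (simp add: d_def algebra_simps)
  then have "integral {0..1} (\<lambda>t. p ((1 - t) *\<^sub>R a + t *\<^sub>R b)) = p a + B / 2 + C / 3"
    by (simp only: q integral_quadratic)
  moreover have "midpoint a b = a + (1/2) *\<^sub>R d" "b = a + 1 *\<^sub>R d"
    by (simp_all add: d_def midpoint_def vec_eq_iff field_simps)
  then have "p (midpoint a b) = p a + B * (1/2) + C * (1/2)\<^sup>2" "p b = p a + B * 1 + C * 1\<^sup>2"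
    using q[of "1/2"] q[of 1] by (simp_all only:)
  ultimately show ?thesis by (simp add: power2_eq_square field_simps)
qed

lemma midpoint_rule:
  assumes "p \<in> poly2 1"
  shows "integral {0..1} (\<lambda>t. p ((1 - t) *\<^sub>R a + t *\<^sub>R b)) = p (midpoint a b)"
proof -
  obtain c where c: "\<And>x. p x = (\<Sum>i\<le>1. \<Sum>j\<le>1 - i. c i j * (x $ 1) ^ i * (x $ 2) ^ j)"
    using assms unfolding poly2_def by auto
  have c': "p x = c 0 0 + c 0 1 * x $ 2 + c 1 0 * x $ 1" for x unfolding c by simp
  have "p ((1 - t) *\<^sub>R a + t *\<^sub>R b) = p a + (p b - p a) * t + 0 * t\<^sup>2" for t
    unfolding c' by (simp add: algebra_simps)
  then have "integral {0..1} (\<lambda>t. p ((1 - t) *\<^sub>R a + t *\<^sub>R b)) = p a + (p b - p a) / 2 + 0 / 3"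
    by (simp only: integral_quadratic)
  then show ?thesis unfolding c' by (simp add: midpoint_def field_simps)
qed

section \<open>Vertices and edges of triangles\<close>

text \<open>If the determinant were 0, dividing by a nonzero component of \<open>b - a\<close> would
  show \<open>c - a\<close> to be a multiple of it, putting \<open>c\<close> on the line through
  \<open>a\<close> and \<open>b\<close>.\<close>

lemma affine_independent_cross2:
  assumes "\<not> affine_dependent {a, b, c}" "a \<noteq> b" "c \<noteq> a" "c \<noteq> b"
  shows "cross2 (b - a) (c - a) \<noteq> 0"
proof
  assume 0: "cross2 (b - a) (c - a) = 0"
  obtain k where k: "c - a = k *\<^sub>R (b - a)"
  proof -
    define d e where "d = b - a" and "e = c - a"
    have d: "d \<noteq> 0" and de: "d $ 1 * e $ 2 = d $ 2 * e $ 1"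
      using 0 assms(2) by (simp_all add: d_def e_def cross2_def)
    have "\<exists>k. e = k *\<^sub>R d"
    proof (cases "d $ 1 = 0")
      case True
      then have "d $ 2 \<noteq> 0" using d by (auto simp: vec_eq_iff forall_2)
      then have "e = (e $ 2 / d $ 2) *\<^sub>R d" using de True by (simp add: vec_eq_iff forall_2)
      then show ?thesis by (rule exI)
    next
      case False
      then have "e $ 2 = e $ 1 / d $ 1 * d $ 2" using de by (simp add: eq_divide_eq mult.commute)
      then have "e = (e $ 1 / d $ 1) *\<^sub>R d" using False by (simp add: vec_eq_iff forall_2)
      then show ?thesis by (rule exI)
    qed
    then show ?thesis using that unfolding d_def e_def by blast
  qed
  have "c = a + (c - a)" by simp
  also have "\<dots> = (1 - k) *\<^sub>R a + k *\<^sub>R b" unfolding k by (simp add: algebra_simps)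
  finally have "c \<in> affine hull {a, b}" unfolding affine_hull_2 by force
  moreover have "{a, b, c} - {c} = {a, b}" using assms by auto
  ultimately have "affine_dependent {a, b, c}" unfolding affine_dependent_def by fastforce
  then show False using assms(1) by simp
qed

lemma triangle_vertices:
  assumes "2 simplex K"
  obtains a b c where "\<not> affine_dependent {a, b, c}" "a \<noteq> b" "c \<noteq> a" "c \<noteq> b" "K = convex hull {a, b, c}"
proof -
  obtain C where C: "\<not> affine_dependent C" "int (card C) = 2 + 1" "K = convex hull C"
    using assms unfolding simplex_def by auto
  then have "card C = 3" by simp
  then obtain a b c where "C = {a, b, c}" "a \<noteq> b" "b \<noteq> c" "a \<noteq> c" by (auto simp: card_3_iff)
  with C that show ?thesis by metis
qed

text \<open>The end points of an edge are extreme points of \<open>K\<close>, hence two of its three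
  vertices; \<open>c\<close> is the remaining one.\<close>

lemma edge_of_triangle:
  assumes K: "2 simplex K" and e: "closed_segment a b edge_of K"
  obtains c where "\<not> affine_dependent {a, b, c}" "a \<noteq> b" "c \<noteq> a" "c \<noteq> b" "K = convex hull {a, b, c}"
proof -
  obtain C where C: "\<not> affine_dependent C" "int (card C) = 2 + 1" "K = convex hull C"
    using K unfolding simplex_def by auto
  have fC: "finite C" using C(2) card.infinite by fastforce
  have ab: "a \<noteq> b" using e unfolding edge_of_def by (auto simp: segment_convex_hull aff_dim_convex_hull)
  have "a extreme_point_of K" "b extreme_point_of K"
    using e extreme_point_of_face[of "closed_segment a b" K] unfolding edge_of_def
    by (auto simp: extreme_point_of_segment)
  then have "a \<in> C" "b \<in> C" using extreme_point_of_convex_hull_affine_independent[OF C(1)] C(3) by auto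
  moreover have "card (C - {a, b}) = 1" using C(2) ab calculation fC by (subst card_Diff_subset) auto
  then obtain c where "C - {a, b} = {c}" by (auto simp: card_1_singleton_iff)
  ultimately have "C = {a, b, c}" "c \<noteq> a" "c \<noteq> b" by auto
  with C ab that show ?thesis by metis
qed

lemma segment_edge_of_triangle:
  assumes "\<not> affine_dependent {a, b, c}" "a \<noteq> b"
  shows "closed_segment a b edge_of convex hull {a, b, c}"
  unfolding edge_of_def segment_convex_hull face_of_convex_hull_affine_independent[OF assms(1)]
  using assms(2) by (intro conjI exI[of _ "{a, b}"]) (simp_all add: aff_dim_convex_hull)

lemma triangle_interior_nonempty:
  assumes "cross2 (b - a) (c - a) \<noteq> 0"
  shows "interior (convex hull {a, b, c}) \<noteq> {}"
proof -
  have "a + (1/3) *\<^sub>R (b - a) + (1/3) *\<^sub>R (c - a) \<in> interior (convex hull {a, b, c})"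
    unfolding triangle_bary(2)[OF assms] using bary_param[OF assms, of "1/3" "1/3"] by simp
  then show ?thesis by blast
qed

lemma triangle_convex_interior:
  fixes K :: "(real^2) set"
  assumes "2 simplex K"
  shows "convex K" "interior K \<noteq> {}"
proof -
  obtain a b c where K: "\<not> affine_dependent {a, b, c}" "a \<noteq> b" "c \<noteq> a" "c \<noteq> b" "K = convex hull {a, b, c}"
    using triangle_vertices[OF assms] .
  show "convex K" "interior K \<noteq> {}"
    using triangle_interior_nonempty[OF affine_independent_cross2[OF K(1-4)]] K(5) by simp_all
qed

text \<open>\<open>ends\<close> is a choice, but a segment determines its end points up to order and
  the midpoint is symmetric.\<close>

lemma edge_midpoint_segment: "edge_midpoint (closed_segment a b) = midpoint a b"
proof -
  obtain r s where rs: "ends (closed_segment a b) = (r, s)" by (cases "ends (closed_segment a b)")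
  have "closed_segment a b = closed_segment r s"
    using someI[of "\<lambda>p. closed_segment a b = closed_segment (fst p) (snd p)" "(a, b)"] rs
    unfolding ends_def by (simp del: closed_segment_eq)
  then have "a = r \<and> b = s \<or> a = s \<and> b = r" by (simp add: doubleton_eq_iff)
  then show ?thesis unfolding edge_midpoint_def rs by (auto simp: midpoint_sym)
qed

lemma finite_edges:
  assumes "conforming_triangulation \<Omega> T"
  shows "finite (edges T)"
proof -
  have "finite {e. e edge_of K}" if "K \<in> T" for K
  proof -
    have "2 simplex K" using assms that by (simp add: conforming_triangulation_def)
    then obtain C where "finite C" "K = convex hull C" unfolding simplex by auto
    then have "finite {F. F face_of K}" by (intro finite_polytope_faces) (simp add: polytope_convex_hull)
    then show ?thesis by (rule rev_finite_subset) (auto simp: edge_of_def)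
  qed
  moreover have "edges T = (\<Union>K\<in>T. {e. e edge_of K})" unfolding edges_def by auto
  ultimately show ?thesis using assms by (auto simp: conforming_triangulation_def triangulation_def)
qed

section \<open>Fluxes of Morley and HCT functions\<close>

text \<open>The mean normal derivative, without the length factor of \<open>edge_integral\<close>,
  which cancels in the quotients of the companion operator. The side \<open>K\<close> and the
  orientation are explicit, as both may differ from those chosen there.\<close>

definition edge_flux :: "(real^2) set \<Rightarrow> real^2 \<Rightarrow> real^2 \<Rightarrow> real^2 \<Rightarrow> (real^2 \<Rightarrow> real) \<Rightarrow> real" where
  "edge_flux K n a b v = integral {0..1} (\<lambda>t. ndtr K n v ((1 - t) *\<^sub>R a + t *\<^sub>R b))"

context
  fixes K :: "(real^2) set" and a b :: "real^2"
  assumes K: "convex K" "interior K \<noteq> {}" and ab: "a \<in> K" "b \<in> K"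
begin

lemma segment_point_in: "t \<in> {0..1} \<Longrightarrow> (1 - t) *\<^sub>R a + t *\<^sub>R b \<in> K"
  using convexD_alt[OF K(1) ab, of t] by auto

lemma edge_flux_integrable:
  assumes "C1_closure K v"
  shows "(\<lambda>t. ndtr K n v ((1 - t) *\<^sub>R a + t *\<^sub>R b)) integrable_on {0..1}"
proof (rule integrable_continuous_real)
  have "continuous_on {0..1} (\<lambda>t. tr K (grad v) ((1 - t) *\<^sub>R a + t *\<^sub>R b))"
    by (rule continuous_on_compose2[OF C1_closure_tr(1)[OF K assms]])
       (auto intro!: continuous_intros segment_point_in)
  then show "continuous_on {0..1} (\<lambda>t. ndtr K n v ((1 - t) *\<^sub>R a + t *\<^sub>R b))"
    unfolding ndtr_def by (intro continuous_intros)
qed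

lemma edge_flux_lincomb:
  assumes "C1_closure K v" "C1_closure K w"
  shows "edge_flux K n a b (\<lambda>x. \<alpha> * v x + \<beta> * w x) = \<alpha> * edge_flux K n a b v + \<beta> * edge_flux K n a b w"
proof -
  have "edge_flux K n a b (\<lambda>x. \<alpha> * v x + \<beta> * w x) =
      integral {0..1} (\<lambda>t. \<alpha> * ndtr K n v ((1 - t) *\<^sub>R a + t *\<^sub>R b) + \<beta> * ndtr K n w ((1 - t) *\<^sub>R a + t *\<^sub>R b))"
    unfolding edge_flux_def
    by (rule integral_cong) (simp add: ndtr_def C1_closure_lincomb(2)[OF K assms] segment_point_in inner_add_right)
  also have "\<dots> = \<alpha> * edge_flux K n a b v + \<beta> * edge_flux K n a b w"
    unfolding edge_flux_def
    by (intro integral_unique has_integral_add has_integral_mult_right integrable_integral edge_flux_integrable assms)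
  finally show ?thesis .
qed

lemma edge_flux_sum:
  assumes "finite E" "\<And>e. e \<in> E \<Longrightarrow> C1_closure K (f e)"
  shows "edge_flux K n a b (\<lambda>x. \<Sum>e\<in>E. k e * f e x) = (\<Sum>e\<in>E. k e * edge_flux K n a b (f e))"
proof -
  have "edge_flux K n a b (\<lambda>x. \<Sum>e\<in>E. k e * f e x) =
      integral {0..1} (\<lambda>t. \<Sum>e\<in>E. k e * ndtr K n (f e) ((1 - t) *\<^sub>R a + t *\<^sub>R b))"
    unfolding edge_flux_def
    using C1_closure_sum[OF K assms, where k = k] segment_point_in
    by (intro integral_cong) (simp add: ndtr_def inner_sum_right)
  also have "\<dots> = (\<Sum>e\<in>E. k e * edge_flux K n a b (f e))"
    unfolding edge_flux_def
    by (intro integral_unique has_integral_sum has_integral_mult_right integrable_integral edge_flux_integrable assms)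
  finally show ?thesis .
qed

lemma quadratic_edge_flux:
  assumes p: "p \<in> poly2 2" and v: "\<And>x. x \<in> interior K \<Longrightarrow> v x = p x"
  shows "C1_closure K v" "edge_flux K n a b v = ndtr K n v (midpoint a b)"
proof -
  have p': "p \<in> poly2 (Suc 1)" using p by (simp add: numeral_2_eq_2)
  have g: "grad v x = grad p x" if "x \<in> interior K" for x
    unfolding grad_def using pd_cong_open[OF open_interior that v] by simp
  have "v differentiable (at x)" if "x \<in> interior K" for x
    using poly2_differentiable[OF p, of x] has_derivative_transform_within_open[OF _ open_interior that, of p _ _ v] v
    unfolding differentiable_def by metis
  then show "C1_closure K v"
    unfolding C1_closure_def using g continuous_grad_poly2[OF p'] by (auto intro!: exI[of _ "grad p"])
  have t: "ndtr K n v x = n \<bullet> grad p x" if "x \<in> K" for x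
    unfolding ndtr_def using tr_eqI[OF K that continuous_grad_poly2[OF p'] g] by simp
  have "midpoint a b \<in> K" using segment_point_in[of "1/2"] by (simp add: midpoint_def scaleR_add_right)
  moreover have "edge_flux K n a b v = integral {0..1} (\<lambda>t. n \<bullet> grad p ((1 - t) *\<^sub>R a + t *\<^sub>R b))"
    unfolding edge_flux_def by (rule integral_cong) (simp add: t segment_point_in)
  ultimately show "edge_flux K n a b v = ndtr K n v (midpoint a b)"
    using midpoint_rule[OF normal_grad_poly2[OF p'], of n a b] t by simp
qed

end

text \<open>The edge lies in a single subtriangle, where \<open>w\<close> is cubic and its normal
  derivative along the edge is therefore quadratic; Simpson's rule is exact for it.\<close>

lemma macro_edge_flux:
  assumes K: "2 simplex K" and e: "closed_segment a b edge_of K" and w: "C1_closure K w"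
    and p: "p \<in> poly2 3" "\<And>x. x \<in> interior (convex hull (insert (centroid K) (closed_segment a b))) \<Longrightarrow> w x = p x"
  shows "edge_flux K n a b w = (ndtr K n w a + 4 * ndtr K n w (midpoint a b) + ndtr K n w b) / 6"
proof -
  obtain c where c: "\<not> affine_dependent {a, b, c}" "a \<noteq> b" "c \<noteq> a" "c \<noteq> b" "K = convex hull {a, b, c}"
    using edge_of_triangle[OF K e] .
  note D = affine_independent_cross2[OF c(1-4)] and K' = triangle_convex_interior[OF K]
  define m where "m = centroid K"
  define S where "S = convex hull {a, b, m}"
  have m: "m = (1/3) *\<^sub>R (a + b + c)"
  proof -
    have "{\<nu>. \<nu> extreme_point_of K} = {a, b, c}"
      unfolding c(5) using extreme_point_of_convex_hull_affine_independent[OF c(1)] by auto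
    then show ?thesis using c(2-4) unfolding m_def centroid_def by (simp add: add_ac)
  qed
  \<comment> \<open>The subtriangle has a third of the area, so it is nondegenerate and traces from
    inside it make sense.\<close>
  have "cross2 (b - a) (m - a) = cross2 (b - a) (c - a) / 3"
    unfolding m cross2_def by (simp add: field_simps)
  then have S: "interior S \<noteq> {}" "convex S"
    unfolding S_def using triangle_interior_nonempty[of b a m] D by auto
  have S_eq: "convex hull (insert m (closed_segment a b)) = S"
    unfolding S_def segment_convex_hull
    using hull_Un_left[of convex "{a, b}" "{m}"] by (simp add: insert_commute)
  have abc: "a \<in> K" "b \<in> K" "c \<in> K" by (auto simp: c(5) hull_inc)
  have "m = a + (1/3) *\<^sub>R (b - a) + (1/3) *\<^sub>R (c - a)"
    unfolding m by (simp add: vec_eq_iff field_simps)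
  then have "m \<in> K"
    unfolding c(5) triangle_bary(1)[OF D] using bary_param[OF D, of "1/3" "1/3"] by simp
  then have SK: "S \<subseteq> K" unfolding S_def using abc K'(1) by (intro hull_minimal) auto
  have p': "p \<in> poly2 (Suc 2)" using p(1) by (simp add: numeral_3_eq_3 numeral_2_eq_2)
  have g: "grad w x = grad p x" if "x \<in> interior S" for x
    unfolding grad_def using pd_cong_open[OF open_interior that, of w p] p(2) S_eq m_def by simp
  have t: "tr K (grad w) x = grad p x" if "x \<in> S" for x
  proof -
    \<comment> \<open>The gradient extends continuously to all of \<open>K\<close>, so approaching
      \<open>x\<close> through the smaller triangle gives the same limit.\<close>
    have "tr S (grad w) x = tr K (grad w) x"
      using C1_closure_tr[OF K' w] SK interior_mono[OF SK]
      by (intro tr_eqI[OF S(2,1) that]) (auto intro: continuous_on_subset)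
    then show ?thesis using tr_eqI[OF S(2,1) that continuous_grad_poly2[OF p'] g] by simp
  qed
  have seg: "(1 - t) *\<^sub>R a + t *\<^sub>R b \<in> S" if "t \<in> {0..1}" for t
    using convexD_alt[OF S(2), of a b t] that by (auto simp: S_def hull_inc)
  have "midpoint a b \<in> S" "a \<in> S" "b \<in> S"
    using seg[of "1/2"] seg[of 0] seg[of 1] by (simp_all add: midpoint_def scaleR_add_right)
  moreover have "edge_flux K n a b w = integral {0..1} (\<lambda>t. n \<bullet> grad p ((1 - t) *\<^sub>R a + t *\<^sub>R b))"
    unfolding edge_flux_def ndtr_def by (rule integral_cong) (simp add: t seg)
  ultimately show ?thesis
    using simpson_rule[OF normal_grad_poly2[OF p'], of n a b] t by (simp add: ndtr_def)
qed

lemma HCT_C1_closure: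
  assumes "w \<in> HCT \<Omega> T" "K \<in> T"
  shows "C1_closure K w"
  using assms by (auto simp: HCT_def C1_on_triangle_def C1_closure_def)

lemma edge_ends_in_vertices:
  assumes "K \<in> T" "closed_segment a b edge_of K"
  shows "a \<in> vertices T" "b \<in> vertices T" "a \<in> K" "b \<in> K"
  using assms extreme_point_of_face[of "closed_segment a b" K] edge_of_imp_subset[OF assms(2)]
  unfolding edge_of_def vertices_def by (auto simp: extreme_point_of_segment)

text \<open>The right-hand side involves degrees of freedom but not \<open>K\<close>, and is
  symmetric in \<open>a\<close> and \<open>b\<close>: the flux of an HCT function is the same from
  both sides and in both orientations.\<close>

lemma HCT_edge_flux:
  assumes T: "conforming_triangulation \<Omega> T" and K: "K \<in> T" and e: "closed_segment a b edge_of K"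
    and w: "w \<in> HCT \<Omega> T" "has_HCT_dofs \<Omega> T n w A g d"
  shows "edge_flux K (n (closed_segment a b)) a b w =
    (n (closed_segment a b) \<bullet> (if a \<in> int_vertices \<Omega> T then g a else 0) +
     4 * (if closed_segment a b \<in> int_edges \<Omega> T then d (closed_segment a b) else 0) +
     n (closed_segment a b) \<bullet> (if b \<in> int_vertices \<Omega> T then g b else 0)) / 6"
proof -
  have K2: "2 simplex K" using T K by (simp add: conforming_triangulation_def)
  obtain p where "p \<in> poly2 3" "\<forall>x\<in>interior (convex hull (insert (centroid K) (closed_segment a b))). w x = p x"
    using w(1) K e unfolding HCT_def by blast
  then have "edge_flux K (n (closed_segment a b)) a b w = (ndtr K (n (closed_segment a b)) w a +
      4 * ndtr K (n (closed_segment a b)) w (midpoint a b) + ndtr K (n (closed_segment a b)) w b) / 6"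
    by (intro macro_edge_flux[OF K2 e HCT_C1_closure[OF w(1) K]]) auto
  moreover have "ndtr K (n (closed_segment a b)) w (midpoint a b) =
      (if closed_segment a b \<in> int_edges \<Omega> T then d (closed_segment a b) else 0)"
    using w(2) K e unfolding has_HCT_dofs_def edge_midpoint_segment[symmetric] by blast
  moreover have "tr K (grad w) a = (if a \<in> int_vertices \<Omega> T then g a else 0)"
    "tr K (grad w) b = (if b \<in> int_vertices \<Omega> T then g b else 0)"
    using w(2) K edge_ends_in_vertices[OF K e] unfolding has_HCT_dofs_def by blast+
  ultimately show ?thesis by (simp only: ndtr_def)
qed

lemma companion_defect_flux:
  assumes \<Omega>: "open \<Omega>" and T: "conforming_triangulation \<Omega> T"
    and Et: "HCT_interpolator \<Omega> T n sel Et" and b: "HCT_edge_basis \<Omega> T n b"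
    and v: "v \<in> morley \<Omega> T n" and K: "K \<in> T"
  defines "w \<equiv> \<lambda>x. v x - companion \<Omega> T n Et b v x"
  shows "C1_closure K w"
    and "closed_segment p q edge_of K \<Longrightarrow> edge_flux K (n (closed_segment p q)) p q w = 0"
proof -
  define E where "E = int_edges \<Omega> T"
  define k where "k e = edge_integral e (ndtr_edge T n e (\<lambda>y. v y - Et v y)) / edge_integral e (ndtr_edge T n e (b e))" for e
  have fE: "finite E" using finite_edges[OF T] by (simp add: E_def int_edges_def)
  have simp2: "2 simplex L" if "L \<in> T" for L using T that by (simp add: conforming_triangulation_def)
  \<comment> \<open>The explicit coefficients 1 and -1 match the shape of the linear-combination
    lemmas.\<close>
  have w_eq: "w = (\<lambda>x. 1 * v x + (-1) * (1 * Et v x + 1 * (\<Sum>e\<in>E. k e * b e x)))"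
    unfolding w_def companion_def k_def E_def by auto
  have EtH: "Et v \<in> HCT \<Omega> T" and Etd: "has_HCT_dofs \<Omega> T n (Et v) (\<lambda>\<nu>. tr (elt_at_vertex T \<nu>) v \<nu>)
       (\<lambda>\<nu>. tr (sel \<nu>) (grad v) \<nu>) (\<lambda>e. ndtr_edge T n e v (edge_midpoint e))"
    using Et v unfolding HCT_interpolator_def by auto
  have bH: "b e \<in> HCT \<Omega> T" and bd: "has_HCT_dofs \<Omega> T n (b e) (\<lambda>_. 0) (\<lambda>_. 0) (\<lambda>e'. if e' = e then 1 else 0)"
    if "e \<in> E" for e
    using b that unfolding HCT_edge_basis_def E_def by auto
  have vq: "\<exists>p\<in>poly2 2. \<forall>x\<in>interior L. v x = p x" if "L \<in> T" for L
    using v that unfolding morley_def by auto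
  have vC: "C1_closure L v" if "L \<in> T" for L
  proof -
    note L = triangle_convex_interior[OF simp2[OF that]]
    obtain x where "x \<in> L" using L(2) interior_subset by blast
    then show ?thesis using quadratic_edge_flux(1)[OF L] vq[OF that] by blast
  qed
  note K' = triangle_convex_interior[OF simp2[OF K]]
  have sumC: "C1_closure K (\<lambda>x. \<Sum>e\<in>E. k e * b e x)"
    using C1_closure_sum[OF K' fE] HCT_C1_closure[OF bH K] by blast
  note EvC = C1_closure_lincomb(1)[OF K' HCT_C1_closure[OF EtH K] sumC]
  show "C1_closure K w" unfolding w_eq by (intro C1_closure_lincomb(1)[OF K' vC[OF K]] EvC)
  have vflux: "edge_flux L n' x y v = ndtr L n' v (midpoint x y)" if "L \<in> T" "x \<in> L" "y \<in> L" for L n' x y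
    using quadratic_edge_flux(2)[OF triangle_convex_interior[OF simp2[OF that(1)]] that(2,3)] vq[OF that(1)] by blast
  show "edge_flux K (n (closed_segment p q)) p q w = 0" if pq: "closed_segment p q edge_of K"
  proof -
    define e where "e = closed_segment p q"
    note ends = edge_ends_in_vertices[OF K pq]
    have eT: "e \<in> edges T" using K pq by (auto simp: edges_def e_def)
    have flux_w: "edge_flux K (n e) p q w = edge_flux K (n e) p q v - (edge_flux K (n e) p q (Et v) +
        (\<Sum>e'\<in>E. k e' * edge_flux K (n e) p q (b e')))"
      unfolding w_eq
      by (subst edge_flux_lincomb[OF K' ends(3,4) vC[OF K] EvC],
          subst edge_flux_lincomb[OF K' ends(3,4) HCT_C1_closure[OF EtH K] sumC],
          subst edge_flux_sum[OF K' ends(3,4) fE HCT_C1_closure[OF bH K]]) auto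
    \<comment> \<open>Among the degrees of freedom of a basis function only the midpoint one on its
      own edge is nonzero; its Simpson weight is 4/6.\<close>
    have flux_b: "edge_flux K (n e) p q (b e') = (if e \<in> E \<and> e = e' then 2 / 3 else 0)" if "e' \<in> E" for e'
      using HCT_edge_flux[OF T K pq bH[OF that] bd[OF that], folded e_def E_def] by (auto split: if_splits)
    note flux_Et = HCT_edge_flux[OF T K pq EtH Etd, folded e_def]
    have flux_v: "edge_flux K (n e) p q v = ndtr K (n e) v (edge_midpoint e)"
      using vflux[OF K ends(3,4)] edge_midpoint_segment[of p q] by (simp add: e_def)
    show ?thesis
    proof (cases "e \<in> E")
      case False
      \<comment> \<open>Both end points lie outside the open domain, so the nodal gradients of
        \<open>Et v\<close> there are 0, like its midpoint value. The Morley boundary condition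
        removes \<open>v\<close>, and no \<open>b e'\<close> belongs to this edge.\<close>
      then have "e \<subseteq> frontier \<Omega>" using eT by (simp add: E_def int_edges_def)
      then have "p \<in> frontier \<Omega>" "q \<in> frontier \<Omega>" by (auto simp: e_def)
      then have "p \<notin> \<Omega>" "q \<notin> \<Omega>" using \<Omega> by (auto simp: frontier_def interior_open)
      then have "edge_flux K (n e) p q (Et v) = 0"
        using flux_Et False by (simp add: int_vertices_def E_def)
      moreover have "(\<Sum>e'\<in>E. k e' * edge_flux K (n e) p q (b e')) = 0"
        using flux_b False by (intro sum.neutral) auto
      moreover have "ndtr K (n e) v (edge_midpoint e) = 0"
        using v eT False K pq unfolding morley_def E_def e_def by auto
      ultimately show ?thesis using flux_w flux_v by (simp add: e_def)
    next
      case True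
      \<comment> \<open>The triangle from which the companion operator reads the edge; it may be the
        neighbour of \<open>K\<close>, and \<open>ends\<close> may list the end points in the other
        order.\<close>
      define L where "L = elt_at_edge T e"
      have L: "L \<in> T" "e edge_of L"
        unfolding L_def elt_at_edge_def using someI_ex[of "\<lambda>K. K \<in> T \<and> e edge_of K"] K pq by (auto simp: e_def)
      obtain r s where rs: "ends e = (r, s)" by (cases "ends e")
      have e_rs: "e = closed_segment r s"
        using someI[of "\<lambda>p. e = closed_segment (fst p) (snd p)" "(p, q)"] rs
        unfolding ends_def by (simp add: e_def)
      have rs_pq: "{r, s} = {p, q}" using e_rs unfolding e_def by simp
      have rs_L: "closed_segment r s edge_of L" using L(2) e_rs by simp
      note L' = triangle_convex_interior[OF simp2[OF L(1)]] and endsL = edge_ends_in_vertices[OF L(1) rs_L]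
      have "r \<noteq> s" using rs_L unfolding edge_of_def by (auto simp: segment_convex_hull aff_dim_convex_hull)
      have ei: "edge_integral e (ndtr_edge T n e f) = dist r s * edge_flux L (n e) r s f" for f
        unfolding edge_integral_def rs ndtr_edge_def edge_flux_def L_def by simp
      have "edge_flux L (n e) r s (b e) = 2 / 3"
        using HCT_edge_flux[OF T L(1) rs_L bH[OF True] bd[OF True]] True by (simp add: E_def flip: e_rs)
      \<comment> \<open>The edge length cancels, being nonzero, and the remaining denominator is
        2/3.\<close>
      then have k: "k e * (2 / 3) = edge_flux L (n e) r s (\<lambda>y. v y - Et v y)"
        unfolding k_def ei using \<open>r \<noteq> s\<close> by simp
      have "edge_flux L (n e) r s (Et v) = edge_flux K (n e) p q (Et v)"
        using HCT_edge_flux[OF T L(1) rs_L EtH Etd, folded e_rs] flux_Et rs_pq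
        by (auto simp: doubleton_eq_iff add_ac)
      \<comment> \<open>By the midpoint rule this is the Morley continuity condition at the
        midpoint.\<close>
      moreover have "edge_flux L (n e) r s v = edge_flux K (n e) p q v"
      proof -
        have "edge_flux L (n e) r s v = ndtr L (n e) v (edge_midpoint e)"
          using vflux[OF L(1) endsL(3,4)] edge_midpoint_segment[of r s] by (simp flip: e_rs)
        also have "\<dots> = ndtr K (n e) v (edge_midpoint e)"
          using v True L K pq unfolding morley_def E_def e_def by blast
        finally show ?thesis by (simp add: flux_v)
      qed
      moreover have "edge_flux L (n e) r s (\<lambda>y. v y - Et v y) = edge_flux L (n e) r s v - edge_flux L (n e) r s (Et v)"
        using edge_flux_lincomb[OF L' endsL(3,4) vC[OF L(1)] HCT_C1_closure[OF EtH L(1)], of _ 1 "-1"] by simp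
      moreover have "(\<Sum>e'\<in>E. k e' * edge_flux K (n e) p q (b e')) = k e * (2 / 3)"
      proof -
        have "(\<Sum>e'\<in>E. k e' * edge_flux K (n e) p q (b e')) = (\<Sum>e'\<in>E. if e' = e then k e * (2 / 3) else 0)"
          by (rule sum.cong) (use flux_b True in auto)
        then show ?thesis using fE True by simp
      qed
      ultimately have "edge_flux K (n e) p q w = 0" using flux_w k by linarith
      then show ?thesis by (simp add: e_def)
    qed
  qed
qed

section \<open>From vanishing fluxes to the weak Laplacian\<close>

text \<open>\<open>Et v\<close> and the \<open>b e\<close> have weak derivatives on the whole
  domain, which restrict to the triangle, where \<open>v\<close> is a quadratic.\<close>

lemma companion_defect_weak_deriv:
  assumes \<Omega>: "open \<Omega>" "interior (closure \<Omega>) = \<Omega>" and T: "conforming_triangulation \<Omega> T"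
    and Et: "HCT_interpolator \<Omega> T n sel Et" and b: "HCT_edge_basis \<Omega> T n b"
    and v: "v \<in> morley \<Omega> T n" and K: "K \<in> T"
  shows "\<exists>g. is_weak_deriv (interior K) [i, i] (\<lambda>x. v x - companion \<Omega> T n Et b v x) g"
proof -
  \<comment> \<open>Triangles are only known to lie in the closure of the domain; regular openness
    brings their interiors into the domain itself.\<close>
  have sub: "interior K \<subseteq> \<Omega>"
  proof -
    have "K \<subseteq> closure \<Omega>" using T K unfolding conforming_triangulation_def by auto
    then show ?thesis using interior_mono \<Omega>(2) by metis
  qed
  have fE: "finite (int_edges \<Omega> T)" using finite_edges[OF T] by (simp add: int_edges_def)
  have HCT: "\<exists>g. is_weak_deriv (interior K) [i, i] w g" if "w \<in> HCT \<Omega> T" for w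
  proof -
    have "w \<in> H2 \<Omega>" using that by (simp add: HCT_def H20_def)
    then obtain g where "is_weak_deriv \<Omega> [i, i] w g"
      unfolding H2_def by (auto dest!: spec[of _ "[i, i]"])
    then show ?thesis using is_weak_deriv_restrict[OF _ sub \<Omega>(1) open_interior] by blast
  qed
  have Ev: "Et v \<in> HCT \<Omega> T" using Et v by (auto simp: HCT_interpolator_def)
  have bH: "b e \<in> HCT \<Omega> T" if "e \<in> int_edges \<Omega> T" for e using b that by (auto simp: HCT_edge_basis_def)
  have "\<exists>p\<in>poly2 2. \<forall>x\<in>interior K. v x = p x" using v K unfolding morley_def by auto
  then obtain p where p: "p \<in> poly2 2" "\<And>x. x \<in> interior K \<Longrightarrow> v x = p x" by blast
  have p': "p \<in> poly2 (Suc (Suc 0))" using p(1) by (simp add: numeral_2_eq_2)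
  have "is_weak_deriv (interior K) [i, i] p (pd i (pd i p))"
    using poly2_differentiable[OF p(1)] poly2_differentiable[OF pd_poly2[OF p']]
      poly2_continuous[OF pd_poly2[OF pd_poly2[OF p']]]
    by (intro is_weak_deriv_classical) auto
  then have wv: "is_weak_deriv (interior K) [i, i] v (pd i (pd i p))"
    by (rule is_weak_deriv_cong) (auto simp: p(2))
  obtain g1 where g1: "is_weak_deriv (interior K) [i, i] (Et v) g1" using HCT[OF Ev] by blast
  let ?k = "\<lambda>e. edge_integral e (ndtr_edge T n e (\<lambda>y. v y - Et v y)) / edge_integral e (ndtr_edge T n e (b e))"
  obtain g2 where g2: "is_weak_deriv (interior K) [i, i] (\<lambda>x. \<Sum>e\<in>int_edges \<Omega> T. ?k e * b e x) g2"
    using weak_deriv_exists_sum[OF fE open_interior, where f = b and c = ?k] HCT[OF bH] by blast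
  from is_weak_deriv_lincomb[OF wv is_weak_deriv_lincomb[OF g1 g2 open_interior, of 1 1] open_interior, of 1 "-1"]
  have "is_weak_deriv (interior K) [i, i] (\<lambda>x. 1 * v x + (-1) * (1 * Et v x + 1 * (\<Sum>e\<in>int_edges \<Omega> T. ?k e * b e x)))
      (\<lambda>x. 1 * pd i (pd i p) x + (-1) * (1 * g1 x + 1 * g2 x))" .
  moreover have "(\<lambda>x. 1 * v x + (-1) * (1 * Et v x + 1 * (\<Sum>e\<in>int_edges \<Omega> T. ?k e * b e x))) =
      (\<lambda>x. v x - companion \<Omega> T n Et b v x)"
    unfolding companion_def by (intro ext) simp
  ultimately show ?thesis by (intro exI) (simp only:)
qed

text \<open>In the plane the vectors orthogonal to \<open>d\<close> form a line. Each component of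
  \<open>d\<close> times \<open>cross2 u n\<close> is a combination of the two inner products, so
  \<open>cross2 u n\<close> is 0; expanding with \<open>norm n = 1\<close> gives the factor.\<close>

lemma orthogonal_parallel:
  fixes u n d :: "real^2"
  assumes "u \<bullet> d = 0" "n \<bullet> d = 0" "norm n = 1" "d \<noteq> 0"
  shows "u = (u \<bullet> n) *\<^sub>R n"
proof -
  have u: "u $ 1 * d $ 1 + u $ 2 * d $ 2 = 0" and nd: "n $ 1 * d $ 1 + n $ 2 * d $ 2 = 0"
    using assms(1,2) by (simp_all add: inner_vec_def sum_2)
  have nn: "n $ 1 * n $ 1 + n $ 2 * n $ 2 = 1"
    using assms(3) by (simp add: norm_eq_1 inner_vec_def sum_2)
  have "d $ 1 * cross2 u n = n $ 2 * (u $ 1 * d $ 1 + u $ 2 * d $ 2) - u $ 2 * (n $ 1 * d $ 1 + n $ 2 * d $ 2)"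
    "d $ 2 * cross2 u n = u $ 1 * (n $ 1 * d $ 1 + n $ 2 * d $ 2) - n $ 1 * (u $ 1 * d $ 1 + u $ 2 * d $ 2)"
    by (simp_all add: cross2_def algebra_simps)
  then have "d $ 1 * cross2 u n = 0" "d $ 2 * cross2 u n = 0" by (simp_all add: u nd)
  then have un: "u $ 1 * n $ 2 = u $ 2 * n $ 1"
    using assms(4) by (auto simp: cross2_def vec_eq_iff forall_2)
  have "u $ 1 = u $ 1 * (n $ 1 * n $ 1 + n $ 2 * n $ 2)" by (simp add: nn)
  also have "\<dots> = u $ 1 * n $ 1 * n $ 1 + (u $ 1 * n $ 2) * n $ 2" by (simp add: algebra_simps)
  also have "\<dots> = (u \<bullet> n) * n $ 1" unfolding un by (simp add: inner_vec_def sum_2 algebra_simps)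
  finally have 1: "u $ 1 = (u \<bullet> n) * n $ 1" .
  have "u $ 2 = u $ 2 * (n $ 1 * n $ 1 + n $ 2 * n $ 2)" by (simp add: nn)
  also have "\<dots> = (u $ 2 * n $ 1) * n $ 1 + u $ 2 * n $ 2 * n $ 2" by (simp add: algebra_simps)
  also have "\<dots> = (u \<bullet> n) * n $ 2" unfolding un[symmetric] by (simp add: inner_vec_def sum_2 algebra_simps)
  finally have "u $ 2 = (u \<bullet> n) * n $ 2" .
  with 1 show ?thesis by (simp add: vec_eq_iff forall_2)
qed

text \<open>\<open>bary_grad a b c\<close> is a multiple of the unit normal \<open>n\<close>, so the
  flux in the form used by the cut-off argument is a multiple of \<open>edge_flux\<close>, whatever
  the sign of \<open>n\<close>.\<close>

lemma bary_grad_edge_flux: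
  assumes d: "a \<noteq> b" and n: "norm n = 1" "n \<bullet> (b - a) = 0"
    and flux: "edge_flux K n a b w = 0"
  shows "integral {0..1} (\<lambda>s. bary_grad a b c \<bullet> tr K (grad w) (a + s *\<^sub>R (b - a))) = 0"
proof -
  have "vector [- ((b - a) $ 2), (b - a) $ 1] \<bullet> (b - a) = 0"
    by (simp add: inner_vec_def sum_2 algebra_simps)
  then have "bary_grad a b c \<bullet> (b - a) = 0" by (simp add: bary_grad_def)
  from orthogonal_parallel[OF this n(2,1)] d
  have "bary_grad a b c \<bullet> tr K (grad w) x = (bary_grad a b c \<bullet> n) * ndtr K n w x" for x
    unfolding ndtr_def by (metis inner_scaleR_left right_minus_eq)
  moreover have "a + s *\<^sub>R (b - a) = (1 - s) *\<^sub>R a + s *\<^sub>R b" for s by (simp add: algebra_simps)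
  ultimately show ?thesis using flux by (simp add: edge_flux_def)
qed

lemma companion_defect_laplacian:
  assumes \<Omega>: "open \<Omega>" "interior (closure \<Omega>) = \<Omega>" and T: "conforming_triangulation \<Omega> T"
    and n: "unit_normals T n"
    and Et: "HCT_interpolator \<Omega> T n sel Et" and b: "HCT_edge_basis \<Omega> T n b"
    and v: "v \<in> morley \<Omega> T n" and K: "K \<in> T"
  shows "(LINT x|lebesgue_on (interior K). wlaplacian (interior K) (\<lambda>x. v x - companion \<Omega> T n Et b v x) x) = 0"
proof -
  define w where "w = (\<lambda>x. v x - companion \<Omega> T n Et b v x)"
  have K2: "2 simplex K" using T K by (simp add: conforming_triangulation_def)
  obtain p q r where abc: "\<not> affine_dependent {p, q, r}" "p \<noteq> q" "r \<noteq> p" "r \<noteq> q" "K = convex hull {p, q, r}"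
    using triangle_vertices[OF K2] .
  note D = affine_independent_cross2[OF abc(1-4)]
  note C1 = companion_defect_flux(1)[OF \<Omega>(1) T Et b v K, folded w_def]
  note K' = triangle_convex_interior[OF K2]
  \<comment> \<open>Stated for any ordering of the vertices, so that it covers all three
    edges.\<close>
  have edge: "integral {0..1} (\<lambda>s. bary_grad x y z \<bullet> tr K (grad w) (x + s *\<^sub>R (y - x))) = 0"
    if xy: "x \<noteq> y" and xyz: "{x, y, z} = {p, q, r}" for x y z
  proof -
    have e: "closed_segment x y edge_of K"
      using segment_edge_of_triangle[of x y z] abc(1,5) xyz xy by simp
    then have "closed_segment x y \<in> edges T" using K by (auto simp: edges_def)
    then have "norm (n (closed_segment x y)) = 1" "n (closed_segment x y) \<bullet> (y - x) = 0"
      using n unfolding unit_normals_def by auto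
    then show ?thesis
      using bary_grad_edge_flux[OF xy] companion_defect_flux(2)[OF \<Omega>(1) T Et b v K e] unfolding w_def by blast
  qed
  have "(LINT x|lebesgue_on (interior (convex hull {p, q, r})). wlaplacian (interior (convex hull {p, q, r})) w x) = 0"
  proof (rule integral_wlaplacian_triangle[OF D, where g = "tr K (grad w)"])
    show "w differentiable (at x)" if "x \<in> interior (convex hull {p, q, r})" for x
      using C1 that abc(5) by (auto simp: C1_closure_def)
    show "continuous_on (convex hull {p, q, r}) (tr K (grad w))"
      "\<And>x. x \<in> interior (convex hull {p, q, r}) \<Longrightarrow> tr K (grad w) x = grad w x"
      using C1_closure_tr[OF K' C1] abc(5) by auto
    show "integral {0..1} (\<lambda>s. bary_grad p q r \<bullet> tr K (grad w) (p + s *\<^sub>R (q - p))) = 0"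
      "integral {0..1} (\<lambda>s. bary_grad q r p \<bullet> tr K (grad w) (q + s *\<^sub>R (r - q))) = 0"
      "integral {0..1} (\<lambda>s. bary_grad r p q \<bullet> tr K (grad w) (r + s *\<^sub>R (p - r))) = 0"
      using abc(2-4) by (intro edge; auto)+
    show "\<exists>h. is_weak_deriv (interior (convex hull {p, q, r})) [i, i] w h" for i
      using companion_defect_weak_deriv[OF \<Omega> T Et b v K, of i] abc(5) by (simp add: w_def)
  qed
  then show ?thesis by (simp add: abc(5) w_def)
qed

lemma B_disc_companion_defect:
  assumes \<Omega>: "open \<Omega>" "interior (closure \<Omega>) = \<Omega>" and T: "conforming_triangulation \<Omega> T"
    and n: "unit_normals T n"
    and Et: "HCT_interpolator \<Omega> T n sel Et" and b: "HCT_edge_basis \<Omega> T n b"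
    and v: "v \<in> morley \<Omega> T n" and z: "z \<in> pw_const T"
  shows "B_disc T z (\<lambda>x. v x - companion \<Omega> T n Et b v x) = 0"
proof -
  let ?w = "\<lambda>x. v x - companion \<Omega> T n Et b v x"
  have "(LINT x|lebesgue_on (interior K). z x * wlaplacian (interior K) ?w x) = 0" if K: "K \<in> T" for K
  proof -
    obtain c where c: "\<And>x. x \<in> interior K \<Longrightarrow> z x = c" using z K unfolding pw_const_def by blast
    have "(LINT x|lebesgue_on (interior K). z x * wlaplacian (interior K) ?w x) =
        (LINT x|lebesgue_on (interior K). c * wlaplacian (interior K) ?w x)"
      by (rule Bochner_Integration.integral_cong) (auto simp: c space_restrict_space)
    \<comment> \<open>A constant factor leaves a Bochner integral even when the function is not
      integrable.\<close>
    also have "\<dots> = 0"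
      using companion_defect_laplacian[OF \<Omega> T n Et b v K] by simp
    finally show ?thesis .
  qed
  then show ?thesis unfolding B_disc_def by simp
qed

theorem theorem6p2:
  fixes \<Omega> \<omega> :: "(real^2) set"
    and I :: "'i set"
    and T :: "'i \<Rightarrow> (real^2) set set"
    and n :: "'i \<Rightarrow> (real^2) set \<Rightarrow> real^2"
    and sel :: "'i \<Rightarrow> real^2 \<Rightarrow> (real^2) set"
    and Et :: "'i \<Rightarrow> (real^2 \<Rightarrow> real) \<Rightarrow> real^2 \<Rightarrow> real"
    and b :: "'i \<Rightarrow> (real^2) set \<Rightarrow> real^2 \<Rightarrow> real"
  assumes "polygon \<Omega>"
    and "\<omega> \<noteq> {}" "open \<omega>" "connected \<omega>" "compact (closure \<omega>)" "closure \<omega> \<subseteq> \<Omega>"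
    and "\<And>\<delta>. \<delta> \<in> I \<Longrightarrow> conforming_triangulation \<Omega> (T \<delta>)"
    and "uniformly_shape_regular I T"
    and "\<And>\<delta>. \<delta> \<in> I \<Longrightarrow> unit_normals (T \<delta>) (n \<delta>)"
    and "\<And>\<delta>. \<delta> \<in> I \<Longrightarrow> vertex_selection \<Omega> (T \<delta>) (sel \<delta>)"
    and "\<And>\<delta>. \<delta> \<in> I \<Longrightarrow> HCT_interpolator \<Omega> (T \<delta>) (n \<delta>) (sel \<delta>) (Et \<delta>)"
    and "\<And>\<delta>. \<delta> \<in> I \<Longrightarrow> HCT_edge_basis \<Omega> (T \<delta>) (n \<delta>) (b \<delta>)"
  shows "\<exists>C>0. \<forall>\<delta>\<in>I. \<forall>l\<in>Hm2 \<Omega>. \<forall>q\<in>L2 \<omega>. \<forall>l\<delta>.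
    (\<forall>v\<in>morley \<Omega> (T \<delta>) (n \<delta>). l\<delta> v = l (companion \<Omega> (T \<delta>) (n \<delta>) (Et \<delta>) (b \<delta>) v)) \<longrightarrow>
    (\<forall>u\<in>L2 \<Omega>. \<forall>z\<in>pw_const (T \<delta>).
      (SUP v\<in>{v \<in> morley \<Omega> (T \<delta>) (n \<delta>). pw_nonzero (T \<delta>) v}.
        let Ev = companion \<Omega> (T \<delta>) (n \<delta>) (Et \<delta>) (b \<delta>) v in
        ennreal (\<bar>B_disc (T \<delta>) z (\<lambda>x. v x - Ev x) + l Ev - l\<delta> v\<bar> / morley_norm (T \<delta>) v))
      \<le> ennreal C * (Hm2_norm \<Omega> (\<lambda>v. l v - B_op \<Omega> u v) + ennreal (L2_nrm \<Omega> (\<lambda>x. u x - z x))))"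
\<comment> \<open>The left-hand side is 0, so any positive constant serves as witness.\<close>
proof (intro exI[of _ 1] conjI ballI allI impI)
  show "(0::real) < 1" by simp
  fix \<delta> and l l\<delta> :: "(real^2 \<Rightarrow> real) \<Rightarrow> real" and q u z :: "real^2 \<Rightarrow> real"
  assume \<delta>: "\<delta> \<in> I" and l\<delta>: "\<forall>v\<in>morley \<Omega> (T \<delta>) (n \<delta>). l\<delta> v = l (companion \<Omega> (T \<delta>) (n \<delta>) (Et \<delta>) (b \<delta>) v)"
    and z: "z \<in> pw_const (T \<delta>)"
  have \<Omega>: "open \<Omega>" "interior (closure \<Omega>) = \<Omega>" using assms(1) by (auto simp: polygon_def)
  \<comment> \<open>\<open>l Ev\<close> and \<open>l\<delta> v\<close> cancel by the definition of
    the discrete functional. The quotient is 0 whatever the norm in its denominator.\<close>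
  have "(let Ev = companion \<Omega> (T \<delta>) (n \<delta>) (Et \<delta>) (b \<delta>) v in
        ennreal (\<bar>B_disc (T \<delta>) z (\<lambda>x. v x - Ev x) + l Ev - l\<delta> v\<bar> / morley_norm (T \<delta>) v)) = 0"
    if "v \<in> morley \<Omega> (T \<delta>) (n \<delta>)" for v
    using B_disc_companion_defect[OF \<Omega> assms(7)[OF \<delta>] assms(9)[OF \<delta>] assms(11)[OF \<delta>] assms(12)[OF \<delta>] that z]
      l\<delta> that by (simp add: Let_def)
  then show "(SUP v\<in>{v \<in> morley \<Omega> (T \<delta>) (n \<delta>). pw_nonzero (T \<delta>) v}.
        let Ev = companion \<Omega> (T \<delta>) (n \<delta>) (Et \<delta>) (b \<delta>) v in
        ennreal (\<bar>B_disc (T \<delta>) z (\<lambda>x. v x - Ev x) + l Ev - l\<delta> v\<bar> / morley_norm (T \<delta>) v))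
      \<le> ennreal 1 * (Hm2_norm \<Omega> (\<lambda>v. l v - B_op \<Omega> u v) + ennreal (L2_nrm \<Omega> (\<lambda>x. u x - z x)))"
    by (intro SUP_least) simp
qed

end
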